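(* Let $n\ge1$ and let $m$ be a positive integer. Let $\eta,\lambda$ be vectors of integers in $\mathcal A^{\tilde A_{n-1}}_m=\{(x_1,\dots,x_n)\in\mathbb R^n: x_1>x_2>\dots>x_n>x_1-m\}$. Then, as $k\to\infty$ with $k\equiv|\eta|+|\lambda|\pmod 2$, the number of walks from $\eta$ to $\lambda$ with exactly $k$ standard steps staying in $\mathcal A^{\tilde A_{n-1}}_m$ is asymptotically $$\frac{2^{n^2-n}}{m^{n-1}}\sqrt{\frac{2}{\pi k}}\left(2\frac{\sin\frac{n\pi}{m}}{\sin\frac{\pi}{m}}\right)^k\prod_{1\le h<t\le n}\left(\sin\frac{\pi(\eta_h-\eta_t)}{m}\cdot\sin\frac{\pi(\lambda_h-\lambda_t)}{m}\right).$$
   Context: For $\eta\in\mathbb R^n$, $|\eta|=\eta_1+\dots+\eta_n$. A walk with $k$ steps from $\eta$ to $\lambda$ is a sequence $p_0=\eta,\dots,p_k=\lambda$ with $p_i-p_{i-1}\in S$; "standard steps" means $S=\{\pm e_1,\dots,\pm e_n\}$ ($e_j$ the standard unit vectors). The walk stays in $R$ if all $p_i\in R$. "Asymptotically $E$" means the ratio of the count to $E$ tends to $1$. *)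

theory Defs
  imports
    "HOL-Analysis.Analysis"
    "HOL-Library.Landau_Symbols"
    "HOL-Library.Real_Mod"
begin

(* Points of R^n are vectors "real ^ 'n" over a finite, linearly ordered index type with
   n = CARD('n); the order gives sense to "x_1 > x_2 > ... > x_n".  The numeral types
   of HOL-Library.Numeral_Type supply an instance for every n >= 1. *)

definition coord_sum :: "real ^ 'n \<Rightarrow> real" where
  "coord_sum x = (\<Sum>j\<in>UNIV. x $ j)"

definition standard_steps :: "(real ^ 'n) set" where
  "standard_steps = (\<Union>j. {axis j 1, - axis j 1})"

(* A walk with k steps is the list [p_0, ..., p_k] of its k + 1 points. *)
definition walks :: "(real ^ 'n) set \<Rightarrow> (real ^ 'n) set \<Rightarrow> real ^ 'n \<Rightarrow> real ^ 'n \<Rightarrow> nat \<Rightarrow>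
    (real ^ 'n) list set" where
  "walks S R a b k = {p. length p = k + 1 \<and> p ! 0 = a \<and> p ! k = b \<and>
     (\<forall>i\<in>{1..k}. p ! i - p ! (i - 1) \<in> S) \<and> (\<forall>i\<le>k. p ! i \<in> R)}"

(* The least and greatest index play the roles of 1 and n in "x_n > x_1 - m". *)
definition alcove_A :: "nat \<Rightarrow> (real ^ 'n::{finite,linorder}) set" where
  "alcove_A m = {x. (\<forall>i j. i < j \<longrightarrow> x $ i > x $ j) \<and>
     x $ Max UNIV > x $ Min UNIV - real m}"

(* sin (n pi / m) / sin (pi / m), where the identical numerator and denominator cancel for
   n = 1.  The case distinction matters only for n = m = 1, where both sines vanish. *)
definition sin_quotient :: "nat \<Rightarrow> nat \<Rightarrow> real" where
  "sin_quotient n m =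
     (if n = 1 then 1 else sin (real n * pi / real m) / sin (pi / real m))"

end

theory Submission
  imports Defs
begin

text \<open>The determinants \<open>det (z a powi x b)\<close>, with all \<open>z a\<close> \<open>m\<close>-th roots of unity, are common
  eigenfunctions of the up-step and the down-step operator on integer points and vanish on the
  walls of the alcove. A point of the alcove is determined by its residues modulo \<open>m\<close> and its
  coordinate sum, which gives completeness. Hence the number of walks is exactly
  \<open>k choose u\<close>, where \<open>u\<close> is the number of up-steps forced by the coordinate sums,
  times \<open>m\<close> to the power \<open>-n\<close> times a finite sum over tuples \<open>z\<close>, whose terms grow like the
  \<open>k\<close>-th power of the modulus of \<open>\<Sum>a. z a\<close>. For distinct roots this modulus is maximal exactly
  when the roots form an arc of consecutive roots, where it is the quotient of sines. The arcs are
  evaluated by Vandermonde's formula, and the binomial coefficient by the asymptotics of the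
  central one.\<close>

section \<open>Vandermonde determinants\<close>

text \<open>The alcove is invariant under translation along (1, ..., 1), so diagonalising the full
  step operator would involve a continuous parameter and a saddle-point estimate. Separating
  up-steps from down-steps avoids this: each kind changes the coordinate sum deterministically, so
  the unbounded direction contributes only the binomial coefficient, the origin of 2^k sqrt(2/(pi
  k)). Everything else is a finite sum over roots of unity.

  There are m arcs, one for each first root. They contribute equally because the phases of
  eigenvalues and eigenfunctions cancel, and this turns m^-n into m^-(n-1). The n! orderings of an
  arc leave no factor n!: together they assemble the Vandermonde determinant at the endpoint. Each
  pair h < t contributes 4 times two sines, whence 2^(n^2-n).

  Arcs with different first roots are different only for n < m or n = 1. An integer point of the
  alcove forces n <= m, so n = m > 1 remains; there no step is possible at all and both sides vanish
  for k > 0.\<close>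

definition idx :: "'n::{finite,linorder} \<Rightarrow> nat" where
  "idx a = card {..<a}"

lemma idx_less_iff: "idx a < idx b \<longleftrightarrow> a < b"
proof -
  have *: "idx a < idx b" if "a < b" for a b :: 'a
    unfolding idx_def using that by (intro psubset_card_mono) auto
  show ?thesis using *[of a b] *[of b a]
    by (metis less_asym linorder_neqE)
qed

lemma idx_le_iff: "idx a \<le> idx b \<longleftrightarrow> a \<le> b"
  using idx_less_iff[of b a] by (simp add: not_less[symmetric])

lemma inj_idx: "inj idx"
  by (rule injI) (metis idx_less_iff less_irrefl linorder_neqE)

text \<open>The indices come from an abstract finite order; their ranks supply the exponents 0, ...,
  n - 1 of the Vandermonde matrix and the positions in an arc.\<close>

lemma bij_betw_idx: "bij_betw (idx :: 'n::{finite,linorder} \<Rightarrow> nat) UNIV {..<CARD('n)}"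
proof -
  have "idx a < CARD('n)" for a :: 'n
    unfolding idx_def by (intro psubset_card_mono) auto
  hence "range (idx :: 'n \<Rightarrow> nat) \<subseteq> {..<CARD('n)}" by auto
  moreover have "card (range (idx :: 'n \<Rightarrow> nat)) = CARD('n)"
    by (rule card_image[OF inj_idx])
  ultimately have "range (idx :: 'n \<Rightarrow> nat) = {..<CARD('n)}"
    by (intro card_subset_eq) auto
  thus ?thesis using inj_idx by (simp add: bij_betw_def)
qed

text \<open>A permutation preserves the sum of all ranks, and a strict decrease at one index would
  lower it.\<close>

lemma permutes_le_imp_id:
  fixes p :: "'n::{finite,linorder} \<Rightarrow> 'n"
  assumes p: "p permutes UNIV" and le: "\<And>i. p i \<le> i"
  shows "p = id"
proof (rule ccontr)
  assume "p \<noteq> id"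
  then obtain i where "p i \<noteq> i" by (auto simp: fun_eq_iff)
  have strict: "idx (p i) < idx i" using \<open>p i \<noteq> i\<close> le[of i] by (simp add: idx_less_iff)
  have "(\<Sum>j\<in>UNIV. idx (p j)) < (\<Sum>j\<in>UNIV. idx (j::'n))"
    using le strict by (intro sum_strict_mono_ex1) (auto simp: idx_le_iff intro!: bexI[of _ i])
  thus False using sum.permute[OF p, of idx] by simp
qed

lemma det_lower_triangular:
  fixes A :: "'a::comm_ring_1 ^ 'n::{finite,linorder} ^ 'n::{finite,linorder}"
  assumes "\<And>i j. i < j \<Longrightarrow> A $ i $ j = 0"
  shows "det A = (\<Prod>i\<in>UNIV. A $ i $ i)"
proof -
  have "of_int (sign p) * (\<Prod>i\<in>UNIV. A $ i $ p i) = 0" if p: "p permutes UNIV" "p \<noteq> id" for p :: "'n \<Rightarrow> 'n"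
  proof -
    obtain i where "\<not> p i \<le> i" using permutes_le_imp_id[OF p(1)] p(2) by blast
    hence "A $ i $ p i = 0" using assms by simp
    hence "(\<Prod>i\<in>UNIV. A $ i $ p i) = 0" by (intro prod_zero) auto
    thus ?thesis by simp
  qed
  hence "det A = (\<Sum>p\<in>{id}. of_int (sign p) * (\<Prod>i\<in>UNIV. A $ i $ p i))"
    unfolding det_def by (intro sum.mono_neutral_right) (auto simp: permutes_id)
  thus ?thesis by simp
qed

text \<open>Row operations of determinant 1 replace the monomials by the monic polynomials
  vanishing at the earlier nodes, which makes the matrix triangular.\<close>

lemma det_vandermonde:
  fixes y :: "'n::{finite,linorder} \<Rightarrow> 'a::idom"
  shows "det ((\<chi> a b. y b ^ idx a) :: 'a ^ 'n::{finite,linorder} ^ 'n::{finite,linorder}) = (\<Prod>(h, t)\<in>{(h, t). h < t}. y t - y h)"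
proof -
  define P where "P a = (\<Prod>c\<in>{..<a}. [:- y c, 1:])" for a
  have deg: "degree (P a) = idx a" for a
    unfolding P_def idx_def by (subst degree_prod_eq_sum_degree) auto
  have lead: "coeff (P a) (idx a) = 1" for a
    unfolding deg[symmetric] by (simp add: P_def lead_coeff_prod)
  have poly_P: "poly (P a) (y b) = (\<Prod>c\<in>{..<a}. y b - y c)" for a b
    by (simp add: P_def poly_prod)
  define C :: "'a ^ 'n::{finite,linorder} ^ 'n::{finite,linorder}" where "C = (\<chi> a i. coeff (P a) (idx i))"
  define V :: "'a ^ 'n::{finite,linorder} ^ 'n::{finite,linorder}" where "V = (\<chi> a b. y b ^ idx a)"
  have "det C = (\<Prod>i\<in>UNIV. C $ i $ i)"
    by (intro det_lower_triangular) (auto simp: C_def deg idx_less_iff intro: coeff_eq_0)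
  hence detC: "det C = 1" by (simp add: C_def lead)
  have CV: "(C ** V) $ a $ b = (\<Prod>c\<in>{..<a}. y b - y c)" for a b
  proof -
    have "(C ** V) $ a $ b = (\<Sum>i\<in>(UNIV::'n set). coeff (P a) (idx i) * y b ^ idx i)"
      by (simp add: matrix_matrix_mult_def C_def V_def)
    also have "\<dots> = (\<Sum>i<CARD('n). coeff (P a) i * y b ^ i)"
      by (rule sum.reindex_bij_betw[OF bij_betw_idx])
    also have "\<dots> = (\<Sum>i\<le>degree (P a). coeff (P a) i * y b ^ i)"
      using bij_betw_idx[where 'n = 'n, THEN bij_betwE]
      by (intro sum.mono_neutral_right) (auto simp: deg intro: coeff_eq_0 le_less_trans)
    also have "\<dots> = poly (P a) (y b)" by (simp add: poly_altdef)
    finally show ?thesis by (simp add: poly_P)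
  qed
  have "det V = det (transpose (C ** V))"
    by (simp add: det_mul detC)
  also have "\<dots> = (\<Prod>i\<in>UNIV. transpose (C ** V) $ i $ i)"
    by (intro det_lower_triangular) (auto simp: transpose_def CV intro!: prod_zero)
  also have "\<dots> = (\<Prod>t\<in>UNIV. \<Prod>h\<in>{..<t}. y t - y h)"
    by (simp add: transpose_def CV)
  also have "\<dots> = (\<Prod>(t, h)\<in>Sigma UNIV (\<lambda>t. {..<t}). y t - y h)"
    by (rule prod.Sigma) auto
  also have "\<dots> = (\<Prod>(h, t)\<in>{(h, t). h < t}. y t - y h)"
    by (rule prod.reindex_bij_witness[where i = prod.swap and j = prod.swap]) auto
  finally show ?thesis by (simp add: V_def)
qed

section \<open>Walks and integer points of the alcove\<close>

lemma walks_outside: "a \<notin> R \<Longrightarrow> walks S R a b k = {}"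
  by (auto simp: walks_def)

lemma walks_0: "a \<in> R \<Longrightarrow> walks S R a b 0 = (if a = b then {[a]} else {})"
  by (auto simp: walks_def length_Suc_conv)

text \<open>Splitting off the first step keeps the endpoint fixed, so inductions on the length vary
  the starting point only.\<close>

lemma walks_Suc:
  assumes "a \<in> R"
  shows "walks S R a b (Suc k) = (\<Union>s\<in>S. (#) a ` walks S R (a + s) b k)"
proof (intro equalityI subsetI)
  fix p assume p: "p \<in> walks S R a b (Suc k)"
  then obtain q where q: "p = a # q" by (cases p) (auto simp: walks_def)
  have "q ! 0 - a \<in> S" using p unfolding walks_def q by (auto dest!: bspec[of _ _ 1])
  moreover have "q \<in> walks S R (a + (q ! 0 - a)) b k"
  proof -
    have "q ! i - q ! (i - 1) \<in> S" if "i \<in> {1..k}" for i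
      using p that unfolding walks_def q by (auto dest!: bspec[of _ _ "Suc i"] simp: nth_Cons')
    moreover have "q ! i \<in> R" if "i \<le> k" for i
      using p that unfolding walks_def q by (auto dest!: spec[of _ "Suc i"])
    ultimately show ?thesis using p by (simp add: walks_def q)
  qed
  ultimately show "p \<in> (\<Union>s\<in>S. (#) a ` walks S R (a + s) b k)" using q by blast
next
  fix p assume "p \<in> (\<Union>s\<in>S. (#) a ` walks S R (a + s) b k)"
  then obtain s q where s: "s \<in> S" and q: "q \<in> walks S R (a + s) b k" and p: "p = a # q" by auto
  have "(a # q) ! i - (a # q) ! (i - 1) \<in> S" if "i \<in> {1..Suc k}" for i
    using s q that by (cases "i = 1") (auto simp: walks_def nth_Cons' dest!: bspec[of _ _ "i - 1"])
  moreover have "(a # q) ! i \<in> R" if "i \<le> Suc k" for i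
    using assms q that by (auto simp: walks_def nth_Cons')
  ultimately show "p \<in> walks S R a b (Suc k)"
    using q by (simp add: walks_def p)
qed

lemma finite_walks: "finite S \<Longrightarrow> finite (walks S R a b k)"
proof (induction k arbitrary: a)
  case 0
  show ?case by (cases "a \<in> R") (auto simp: walks_0 walks_outside)
next
  case (Suc k)
  show ?case by (cases "a \<in> R") (use Suc in \<open>auto simp: walks_Suc walks_outside\<close>)
qed

lemma card_walks_Suc:
  assumes "a \<in> R" "finite S"
  shows "card (walks S R a b (Suc k)) = (\<Sum>s\<in>S. card (walks S R (a + s) b k))"
proof -
  have "card (\<Union>s\<in>S. (#) a ` walks S R (a + s) b k)
      = (\<Sum>s\<in>S. card ((#) a ` walks S R (a + s) b k))"
  proof (rule card_UN_disjoint)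
    \<comment> \<open>The tails are told apart by their first points \<open>a + s\<close> and
      \<open>a + t\<close>.\<close>
    have "walks S R (a + s) b k \<inter> walks S R (a + t) b k = {}" if "s \<noteq> t" for s t
      using that by (auto simp: walks_def)
    thus "\<forall>s\<in>S. \<forall>t\<in>S. s \<noteq> t \<longrightarrow>
        (#) a ` walks S R (a + s) b k \<inter> (#) a ` walks S R (a + t) b k = {}"
      by blast
  qed (use assms(2) in \<open>simp_all add: finite_walks\<close>)
  thus ?thesis by (simp add: walks_Suc[OF assms(1)] card_image)
qed

lemma sum_standard_steps:
  "(\<Sum>s\<in>standard_steps. f s) = (\<Sum>j\<in>UNIV. f (axis j 1) + f (- axis j 1 :: real ^ 'n))"
proof -
  have ne: "axis i 1 \<noteq> (- axis j 1 :: real ^ 'n)" for i j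
    by (auto simp: vec_eq_iff axis_def dest!: spec[of _ i] split: if_splits)
  have "standard_steps = range (\<lambda>j. axis j 1 :: real ^ 'n) \<union> range (\<lambda>j. - axis j 1)"
    by (auto simp: standard_steps_def)
  also have "sum f \<dots> = sum f (range (\<lambda>j. axis j 1)) + sum f (range (\<lambda>j. - axis j 1))"
    using ne by (intro sum.union_disjoint) auto
  also have "\<dots> = (\<Sum>j\<in>UNIV. f (axis j 1)) + (\<Sum>j\<in>UNIV. f (- axis j 1))"
    by (simp add: sum.reindex inj_on_def axis_eq_axis)
  finally show ?thesis by (simp add: sum.distrib)
qed

lemma finite_standard_steps: "finite (standard_steps :: (real ^ 'n) set)"
  by (auto simp: standard_steps_def)

text \<open>Integer points are carried as functions into \<open>int\<close>, so that their
  coordinates can serve as exponents of roots of unity and be compared modulo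
  \<open>m\<close>.\<close>

definition int_vec :: "('n \<Rightarrow> int) \<Rightarrow> real ^ 'n" where
  "int_vec h = (\<chi> j. of_int (h j))"

lemma int_vec_eq_iff: "int_vec g = int_vec h \<longleftrightarrow> g = h"
  by (auto simp: int_vec_def vec_eq_iff)

text \<open>The form \<open>h c + - 1\<close> makes both directions instances of
  \<open>h(c := h c + e)\<close> with \<open>e = 1\<close> or \<open>e = -1\<close>.\<close>

lemma int_vec_step: "int_vec h + axis c 1 = int_vec (h(c := h c + 1))"
    "int_vec h + - axis c 1 = int_vec (h(c := h c + - 1))"
  by (auto simp: int_vec_def vec_eq_iff axis_def)

definition alcove_int :: "nat \<Rightarrow> ('n::{finite,linorder} \<Rightarrow> int) set" where
  "alcove_int m = {h. (\<forall>i j. i < j \<longrightarrow> h j < h i) \<and> h (Min UNIV) - int m < h (Max UNIV)}"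

lemma int_vec_in_alcove_iff: "int_vec h \<in> alcove_A m \<longleftrightarrow> h \<in> alcove_int m"
proof -
  have "real_of_int (h (Max UNIV)) > real_of_int (h (Min UNIV)) - real m
      \<longleftrightarrow> h (Min UNIV) - int m < h (Max UNIV)" by linarith
  thus ?thesis by (simp add: alcove_int_def alcove_A_def int_vec_def)
qed

lemma alcove_int_diff_less:
  assumes "h \<in> alcove_int m"
  shows "h a - h b < int m"
proof -
  have anti: "h j \<le> h i" if "i \<le> j" for i j
    using assms that by (cases "i = j") (auto simp: alcove_int_def intro: less_imp_le)
  have "h a \<le> h (Min UNIV)" "h (Max UNIV) \<le> h b" by (auto intro!: anti)
  thus ?thesis using assms by (auto simp: alcove_int_def)
qed

text \<open>A unit step cannot jump over a wall: a strict inequality between integers that fails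
  after a change by 1 has become an equality. On either kind of wall two coordinates agree modulo
  \<open>m\<close>, which is where the determinants vanish.\<close>

lemma alcove_int_exit:
  fixes h :: "'n::{finite,linorder} \<Rightarrow> int"
  assumes h: "h \<in> alcove_int m" and m: "m > 0" and e: "e = 1 \<or> e = -1"
    and out: "h(c := h c + e) \<notin> alcove_int m"
  obtains i j where "i \<noteq> j" "int m dvd (h(c := h c + e)) i - (h(c := h c + e)) j"
proof -
  define g where "g = h(c := h c + e)"
  consider i j where "i < j" "g i \<le> g j" | "g (Max UNIV) \<le> g (Min UNIV) - int m"
    using out by (force simp: alcove_int_def g_def[symmetric])
  then obtain i j where "i \<noteq> j" "int m dvd g i - g j"
  proof cases
    case 1
    have "h j < h i" using h 1 by (auto simp: alcove_int_def)
    hence "g i = g j" using 1 e by (auto simp: g_def split: if_splits)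
    thus ?thesis using 1 by (intro that[of i j]) auto
  next
    case 2
    have "h (Min UNIV) - int m < h (Max UNIV)" using h by (auto simp: alcove_int_def)
    hence "g (Min UNIV) - g (Max UNIV) = int m" "Min UNIV \<noteq> (Max UNIV :: 'n)"
      using 2 e m by (auto simp: g_def split: if_splits)
    thus ?thesis by (intro that[of "Min UNIV" "Max UNIV"]) auto
  qed
  thus thesis by (intro that) (auto simp: g_def)
qed

text \<open>Write \<open>g (p a) - h a = m * t a\<close>. Coordinates of one point differ by less
  than \<open>m\<close>, so the \<open>t a\<close> differ by at most 1 from each other; having sum
  0, they all vanish. Then \<open>p\<close> carries one decreasing sequence to another and is the
  identity. The hypothesis \<open>sum\<close> excludes the rotation of (x_1, ..., x_n) to (x_2, ...,
  x_n, x_1 - m), which stays in the alcove and preserves residues.\<close>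

lemma alcove_int_unique:
  fixes g h :: "'n::{finite,linorder} \<Rightarrow> int"
  assumes g: "g \<in> alcove_int m" and h: "h \<in> alcove_int m"
    and p: "p permutes UNIV" and cong: "\<And>a. int m dvd g (p a) - h a"
    and sum: "(\<Sum>a\<in>UNIV. g a) = (\<Sum>a\<in>UNIV. h a)"
  shows "p = id \<and> g = h"
proof -
  \<comment> \<open>With equal indices the bound reads \<open>0 < int m\<close>;
    \<open>undefined\<close> is just some index.\<close>
  have m: "m > 0" using alcove_int_diff_less[OF g, of undefined undefined] by simp
  have "\<exists>t. g (p a) - h a = int m * t" for a using cong[of a] by (auto elim: dvdE)
  then obtain t where t: "g (p a) - h a = int m * t a" for a by metis
  have "int m * (\<Sum>a\<in>UNIV. t a) = (\<Sum>a\<in>UNIV. g (p a)) - (\<Sum>a\<in>UNIV. h a)"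
    by (simp add: t[symmetric] sum_distrib_left sum_subtractf)
  also have "\<dots> = 0" using sum sum.permute[OF p, of g] by simp
  finally have sum_t: "(\<Sum>a\<in>UNIV. t a) = 0" using m by simp
  have t_diff: "t a - t b < 2" for a b
  proof -
    have "int m * (t a - t b) = (g (p a) - g (p b)) + (h b - h a)"
      using t[of a] t[of b] by (simp add: algebra_simps)
    also have "\<dots> < int m * 2"
      using alcove_int_diff_less[OF g, of "p a" "p b"] alcove_int_diff_less[OF h, of b a] by simp
    finally show ?thesis using m by simp
  qed
  have "t a = 0" for a
  proof (rule ccontr)
    assume "t a \<noteq> 0"
    then consider "t a > 0" | "t a < 0" by linarith
    thus False
    proof cases
      case 1
      hence "t b \<ge> 0" for b using t_diff[of a b] by linarith
      hence "(\<Sum>b\<in>UNIV. t b) > 0" using 1 by (intro sum_pos2[of _ a]) auto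
      thus False using sum_t by simp
    next
      case 2
      hence "- t b \<ge> 0" for b using t_diff[of b a] by linarith
      hence "(\<Sum>b\<in>UNIV. - t b) > 0" using 2 by (intro sum_pos2[of _ a]) auto
      thus False using sum_t by (simp add: sum_negf)
    qed
  qed
  hence gp: "g (p a) = h a" for a using t[of a] by simp
  have mono: "p a < p b" if "a < b" for a b
  proof (rule ccontr)
    assume "\<not> p a < p b"
    hence "g (p a) \<le> g (p b)"
      using g unfolding alcove_int_def by (metis (lifting) mem_Collect_eq less_imp_le linorder_neqE order_refl)
    thus False using that h gp by (force simp: alcove_int_def)
  qed
  have "idx (p a) = idx a" for a
  proof -
    have "p b < p a \<longleftrightarrow> b < a" for b
      using mono[of a b] mono[of b a] by (metis less_asym less_irrefl linorder_neqE)
    hence "p -` {..<p a} = {..<a}" by auto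
    hence "{..<p a} = p ` {..<a}" using permutes_surj[OF p] by (metis surj_image_vimage_eq)
    thus ?thesis using permutes_inj[OF p] by (simp add: idx_def card_image inj_on_subset)
  qed
  hence "p = id" by (auto simp: fun_eq_iff inj_eq[OF inj_idx])
  thus ?thesis using gp by auto
qed

section \<open>The exact number of walks\<close>

text \<open>In the Leibniz term of \<open>p\<close>, raising the exponent in column \<open>c\<close>
  contributes the factor \<open>z a powi e\<close> of the one row with \<open>p a = c\<close>. Only
  the sum over all \<open>c\<close> gives a factor that is the same for every
  \<open>p\<close>.\<close>

lemma det_powi_shift:
  fixes z :: "'n::finite \<Rightarrow> complex" and h :: "'n \<Rightarrow> int"
  assumes z: "\<And>a. z a \<noteq> 0"
  shows "(\<Sum>c\<in>UNIV. det ((\<chi> a b. z a powi (h(c := h c + e)) b) :: complex ^ 'n ^ 'n))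
    = (\<Sum>a\<in>UNIV. z a powi e) * det ((\<chi> a b. z a powi h b) :: complex ^ 'n ^ 'n)"
proof -
  have "(\<Sum>c\<in>UNIV. \<Prod>a\<in>UNIV. z a powi (h(c := h c + e)) (p a))
      = (\<Sum>a\<in>UNIV. z a powi e) * (\<Prod>a\<in>UNIV. z a powi h (p a))"
    if p: "p permutes UNIV" for p :: "'n \<Rightarrow> 'n"
  proof -
    \<comment> \<open>Replacing \<open>c\<close> by \<open>p c\<close> names the affected row
      instead of the affected column.\<close>
    have "(\<Sum>c\<in>UNIV. \<Prod>a\<in>UNIV. z a powi (h(c := h c + e)) (p a))
        = (\<Sum>c\<in>UNIV. \<Prod>a\<in>UNIV. z a powi (h(p c := h (p c) + e)) (p a))"
      using sum.permute[OF p, of "\<lambda>c. \<Prod>a\<in>UNIV. z a powi (h(c := h c + e)) (p a)"]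
      by (simp add: o_def)
    also have "\<dots> = (\<Sum>c\<in>UNIV. \<Prod>a\<in>UNIV. (if a = c then z a powi e else 1) * z a powi h (p a))"
      using z permutes_inj[OF p]
      by (intro sum.cong prod.cong refl) (auto simp: power_int_add inj_eq)
    also have "\<dots> = (\<Sum>c\<in>UNIV. z c powi e * (\<Prod>a\<in>UNIV. z a powi h (p a)))"
      by (simp add: prod.distrib)
    finally show ?thesis by (simp add: sum_distrib_right)
  qed
  note perm = this
  have "(\<Sum>c\<in>UNIV. det ((\<chi> a b. z a powi (h(c := h c + e)) b) :: complex ^ 'n ^ 'n))
      = (\<Sum>p | p permutes UNIV. of_int (sign p) *
          (\<Sum>c\<in>UNIV. \<Prod>a\<in>UNIV. z a powi (h(c := h c + e)) (p a)))"
    by (simp add: det_def sum_distrib_left sum.swap[of _ UNIV])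
  also have "\<dots> = (\<Sum>p | p permutes UNIV. of_int (sign p) *
          ((\<Sum>a\<in>UNIV. z a powi e) * (\<Prod>a\<in>UNIV. z a powi h (p a))))"
    by (intro sum.cong refl arg_cong2[where f = "(*)"], rule perm) simp
  also have "\<dots> = (\<Sum>a\<in>UNIV. z a powi e) * det ((\<chi> a b. z a powi h b) :: complex ^ 'n ^ 'n)"
    by (simp add: det_def sum_distrib_left mult_ac)
  finally show ?thesis .
qed

section \<open>Roots of unity and their orthogonality relation\<close>

definition unity_roots :: "nat \<Rightarrow> complex set" where
  "unity_roots m = {z. z ^ m = 1}"

lemma finite_unity_roots: "m > 0 \<Longrightarrow> finite (unity_roots m)"
  unfolding unity_roots_def by (rule finite_roots_unity) simp

lemma card_unity_roots: "m > 0 \<Longrightarrow> card (unity_roots m) = m"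
  unfolding unity_roots_def by (rule card_roots_unity_eq)

lemma unity_roots_nonzero: "m > 0 \<Longrightarrow> z \<in> unity_roots m \<Longrightarrow> z \<noteq> 0"
  by (auto simp: unity_roots_def zero_power)

lemma unity_roots_norm: "m > 0 \<Longrightarrow> z \<in> unity_roots m \<Longrightarrow> cmod z = 1"
proof -
  assume "m > 0" "z \<in> unity_roots m"
  hence "cmod z ^ m = 1 ^ m" by (simp add: unity_roots_def flip: norm_power)
  thus "cmod z = 1" by (rule power_eq_imp_eq_base) (use \<open>m > 0\<close> in auto)
qed

lemma cnj_powi_unit: "cmod z = 1 \<Longrightarrow> cnj (z powi x) = z powi (- x)"
proof -
  assume "cmod z = 1"
  hence "cnj z = inverse z" by (simp add: inverse_complex_def complex_eq_iff cmod_def)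
  thus ?thesis by (simp add: power_int_minus power_int_inverse)
qed

lemma unity_roots_mult: "z \<in> unity_roots m \<Longrightarrow> w \<in> unity_roots m \<Longrightarrow> z * w \<in> unity_roots m"
  by (simp add: unity_roots_def power_mult_distrib)

lemma unity_roots_powi_dvd: "z \<in> unity_roots m \<Longrightarrow> int m dvd x \<Longrightarrow> z powi x = 1"
  by (auto simp: unity_roots_def power_int_mult elim!: dvdE)

lemma unity_roots_powi_cong:
  assumes "m > 0" "z \<in> unity_roots m" "int m dvd x - y"
  shows "z powi x = z powi y"
proof -
  have "z powi x = z powi (x - y) * z powi y"
    using unity_roots_nonzero[OF assms(1,2)] by (subst power_int_add[symmetric]) auto
  thus ?thesis using unity_roots_powi_dvd[OF assms(2,3)] by simp
qed

lemma primitive_root_powi_eq_1_iff: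
  assumes "m > 0"
  shows "cis (2 * pi / real m) powi x = 1 \<longleftrightarrow> int m dvd x"
proof -
  have "cis (2 * pi / real m) powi x = 1 \<longleftrightarrow> (\<exists>k::int. of_int x * (2 * pi / real m) = 2 * pi * of_int k)"
    unfolding cis_power_int by (metis cis_eq_1_iff mult.commute)
  also have "\<dots> \<longleftrightarrow> (\<exists>k::int. real_of_int x = of_int (int m * k))"
    using assms by (intro ex_cong1) (auto simp: field_simps)
  finally show ?thesis by (simp only: of_int_eq_iff dvd_def)
qed

lemma primitive_root_in: "m > 0 \<Longrightarrow> cis (2 * pi / real m) \<in> unity_roots m"
  using primitive_root_powi_eq_1_iff[of m "int m"] by (simp add: unity_roots_def)

text \<open>Multiplication by a primitive root \<open>w\<close> permutes the roots and scales the
  sum by \<open>w powi x\<close>, which differs from 1 unless \<open>m\<close> divides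
  \<open>x\<close>.\<close>

lemma sum_unity_roots_powi:
  assumes m: "m > 0"
  shows "(\<Sum>z\<in>unity_roots m. z powi x) = (if int m dvd x then of_nat m else 0)"
proof (cases "int m dvd x")
  case True
  thus ?thesis using m by (simp add: unity_roots_powi_dvd card_unity_roots)
next
  case False
  define w where "w = cis (2 * pi / real m)"
  have w: "w \<in> unity_roots m" using m by (simp add: w_def primitive_root_in)
  have w': "inverse w \<in> unity_roots m" using w by (simp add: unity_roots_def power_inverse)
  have w0: "w \<noteq> 0" using w m by (rule unity_roots_nonzero[rotated])
  have "(\<Sum>z\<in>unity_roots m. z powi x) = (\<Sum>z\<in>unity_roots m. (w * z) powi x)"
    by (rule sum.reindex_bij_witness[where i = "\<lambda>z. w * z" and j = "\<lambda>z. inverse w * z"])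
       (use w w' w0 in \<open>auto intro: unity_roots_mult simp flip: mult.assoc\<close>)
  also have "\<dots> = w powi x * (\<Sum>z\<in>unity_roots m. z powi x)"
    by (simp add: power_int_mult_distrib sum_distrib_left)
  finally have "(w powi x - 1) * (\<Sum>z\<in>unity_roots m. z powi x) = 0"
    by (simp add: algebra_simps)
  thus ?thesis using False primitive_root_powi_eq_1_iff[OF m] by (auto simp: w_def)
qed

text \<open>Over \<open>UNIV\<close> the extensional function space is simply the set of functions
  into \<open>unity_roots m\<close>; this form is the one to which \<open>prod_sum_PiE\<close>
  applies.\<close>

definition root_tuples :: "nat \<Rightarrow> ('n::finite \<Rightarrow> complex) set" where
  "root_tuples m = (UNIV \<rightarrow>\<^sub>E unity_roots m)"

lemma finite_root_tuples: "m > 0 \<Longrightarrow> finite (root_tuples m)"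
  unfolding root_tuples_def by (intro finite_PiE finite_unity_roots) auto

lemma root_tuples_iff: "z \<in> root_tuples m \<longleftrightarrow> (\<forall>a. z a \<in> unity_roots m)"
  by (auto simp: root_tuples_def PiE_iff)

text \<open>The factor at the endpoint \<open>l\<close> is a single monomial, conjugate to that of
  exponent \<open>l\<close> on the unit circle, rather than a conjugate determinant. Summation over
  all tuples antisymmetrises it, so no division by n! is required.\<close>

definition amplitude :: "('n::finite \<Rightarrow> int) \<Rightarrow> ('n \<Rightarrow> int) \<Rightarrow> ('n \<Rightarrow> complex) \<Rightarrow> complex" where
  "amplitude l h z = (\<Prod>a\<in>UNIV. z a powi (- l a)) * det (\<chi> a b. z a powi h b)"

text \<open>Up-steps and down-steps multiply each determinant by the scalars \<open>\<Sum>a. z a\<close> and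
  \<open>cnj (\<Sum>a. z a)\<close>, so the number of walks with a prescribed pattern of signs depends only
  on the number \<open>u\<close> of up-steps and \<open>d\<close> of down-steps. It is the following quantity
  if \<open>u - d\<close> is the difference of the coordinate sums.\<close>

definition propagator ::
    "nat \<Rightarrow> ('n::finite \<Rightarrow> int) \<Rightarrow> nat \<Rightarrow> nat \<Rightarrow> ('n \<Rightarrow> int) \<Rightarrow> complex" where
  "propagator m l u d h = (\<Sum>z\<in>root_tuples m. amplitude l h z *
      (\<Sum>a\<in>UNIV. z a) ^ u * cnj (\<Sum>a\<in>UNIV. z a) ^ d) / of_nat m ^ CARD('n)"

lemma amplitude_shift:
  fixes z :: "'n::finite \<Rightarrow> complex" and h :: "'n \<Rightarrow> int"
  assumes "\<And>a. z a \<noteq> 0"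
  shows "(\<Sum>c\<in>UNIV. amplitude l (h(c := h c + e)) z) = (\<Sum>a\<in>UNIV. z a powi e) * amplitude l h z"
  using det_powi_shift[OF assms, where h = h and e = e]
  by (simp add: amplitude_def mult.left_commute flip: sum_distrib_left)

lemma sum_propagator:
  "(\<Sum>c\<in>C. propagator m l u d (g c)) = (\<Sum>z\<in>root_tuples m. (\<Sum>c\<in>C. amplitude l (g c) z) *
      (\<Sum>a\<in>UNIV. z a) ^ u * cnj (\<Sum>a\<in>UNIV. z a) ^ d) / of_nat m ^ CARD('n)"
  for l :: "'n::finite \<Rightarrow> int"
  unfolding propagator_def sum_divide_distrib[symmetric] sum_distrib_right
  by (subst sum.swap) simp

lemma propagator_up:
  assumes m: "m > 0"
  shows "(\<Sum>c\<in>UNIV. propagator m l u d (h(c := h c + 1))) = propagator m l (Suc u) d h"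
proof -
  have "(\<Sum>c\<in>UNIV. amplitude l (h(c := h c + 1)) z) = (\<Sum>a\<in>UNIV. z a) * amplitude l h z"
    if "z \<in> root_tuples m" for z
    using amplitude_shift[of z l h 1] that m by (auto simp: root_tuples_iff dest: unity_roots_nonzero)
  thus ?thesis
    by (subst sum_propagator) (simp add: propagator_def mult_ac cong: sum.cong)
qed

lemma propagator_down:
  assumes m: "m > 0"
  shows "(\<Sum>c\<in>UNIV. propagator m l u d (h(c := h c + -1))) = propagator m l u (Suc d) h"
proof -
  have "(\<Sum>c\<in>UNIV. amplitude l (h(c := h c + -1)) z) = cnj (\<Sum>a\<in>UNIV. z a) * amplitude l h z"
    if z: "z \<in> root_tuples m" for z
  proof -
    have "z a powi -1 = cnj (z a)" for a
      using cnj_powi_unit[of "z a" 1] unity_roots_norm[OF m] z by (simp add: root_tuples_iff)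
    thus ?thesis
      using amplitude_shift[of z l h "-1"] z m
      by (auto simp: root_tuples_iff dest: unity_roots_nonzero)
  qed
  thus ?thesis
    by (subst sum_propagator) (simp add: propagator_def mult_ac cong: sum.cong)
qed

text \<open>For \<open>m\<close>-th roots of unity, congruent coordinates give identical columns.
  This covers the walls x_i = x_j and the affine wall x_1 - x_n = m alike.\<close>

lemma propagator_wall:
  assumes m: "m > 0" and ij: "i \<noteq> j" "int m dvd h i - h j"
  shows "propagator m l u d h = 0"
proof -
  have "amplitude l h z = 0" if "z \<in> root_tuples m" for z
  proof -
    have "det (\<chi> a b. z a powi h b) = 0"
      using ij that unity_roots_powi_cong[OF m]
      by (intro det_identical_columns[OF ij(1)]) (auto simp: column_def root_tuples_iff)
    thus ?thesis by (simp add: amplitude_def)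
  qed
  thus ?thesis by (simp add: propagator_def)
qed

text \<open>Completeness: after expansion of the determinant, orthogonality in each
  \<open>z a\<close> separately leaves the permutations with \<open>h (p a)\<close> congruent to
  \<open>l a\<close> for all \<open>a\<close>, and \<open>alcove_int_unique\<close> leaves only the
  identity, with \<open>h = l\<close>.\<close>

lemma propagator_0:
  fixes h l :: "'n::{finite,linorder} \<Rightarrow> int"
  assumes h: "h \<in> alcove_int m" and l: "l \<in> alcove_int m" and m: "m > 0"
    and sum: "(\<Sum>a\<in>UNIV. h a) = (\<Sum>a\<in>UNIV. l a)"
  shows "propagator m l 0 0 h = (if h = l then 1 else 0)"
proof -
  have "(\<Sum>z\<in>root_tuples m. amplitude l h z)
      = (\<Sum>z\<in>root_tuples m. \<Sum>p | p permutes UNIV. of_int (sign p) *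
          (\<Prod>a\<in>UNIV. z a powi (h (p a) - l a)))"
  proof (intro sum.cong refl)
    fix z :: "'n \<Rightarrow> complex" assume "z \<in> root_tuples m"
    hence "z a powi (- l a) * z a powi x = z a powi (x - l a)" for a x
      using unity_roots_nonzero[OF m] by (simp add: root_tuples_iff power_int_add[symmetric])
    thus "amplitude l h z = (\<Sum>p | p permutes UNIV. of_int (sign p) *
          (\<Prod>a\<in>UNIV. z a powi (h (p a) - l a)))"
      by (simp add: amplitude_def det_def sum_distrib_left mult.left_commute
          flip: prod.distrib)
  qed
  also have "\<dots> = (\<Sum>p | p permutes UNIV. of_int (sign p) *
      (\<Sum>z\<in>root_tuples m. \<Prod>a\<in>UNIV. z a powi (h (p a) - l a)))"
    by (subst sum.swap) (simp add: sum_distrib_left)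
  also have "\<dots> = (\<Sum>p | p permutes UNIV. of_int (sign p) *
      (\<Prod>a\<in>UNIV. if int m dvd h (p a) - l a then of_nat m else 0))"
    unfolding root_tuples_def using m
    by (subst prod_sum_PiE[symmetric])
       (auto simp: finite_unity_roots sum_unity_roots_powi)
  also have "\<dots> = (\<Sum>p | p permutes (UNIV :: 'n set). if p = id \<and> h = l then of_nat m ^ CARD('n) else 0)"
  proof (intro sum.cong refl)
    fix p :: "'n \<Rightarrow> 'n" assume "p \<in> {p. p permutes UNIV}"
    hence p: "p permutes UNIV" by simp
    show "of_int (sign p) * (\<Prod>a\<in>UNIV. if int m dvd h (p a) - l a then of_nat m else 0)
        = (if p = id \<and> h = l then of_nat m ^ CARD('n) else 0 :: complex)"
    proof (cases "\<forall>a. int m dvd h (p a) - l a")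
      case True
      hence "p = id \<and> h = l" using alcove_int_unique[OF h l p _ sum] by blast
      thus ?thesis by simp
    next
      case False
      then obtain a where a: "\<not> int m dvd h (p a) - l a" by blast
      hence "(\<Prod>a\<in>UNIV. if int m dvd h (p a) - l a then of_nat m else 0) = (0::complex)"
        by (intro prod_zero) auto
      moreover have "\<not> (p = id \<and> h = l)" using a by auto
      ultimately show ?thesis by simp
    qed
  qed
  also have "\<dots> = (if h = l then of_nat m ^ CARD('n) else 0)"
    by (cases "h = l") (simp_all add: sum.delta permutes_id)
  finally show ?thesis using m by (simp add: propagator_def)
qed

text \<open>Pascal's rule in the shape of the walk recursion: \<open>f (Suc u)\<close> belongs to a
  first step upwards, \<open>f u\<close> to a first step downwards.\<close>

lemma sum_binomial_Suc:
  fixes f :: "nat \<Rightarrow> 'a::comm_semiring_1"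
  shows "(\<Sum>u\<le>Suc k. of_nat (Suc k choose u) * f u)
    = (\<Sum>u\<le>k. of_nat (k choose u) * (f (Suc u) + f u))"
proof -
  have "(\<Sum>u\<le>Suc k. of_nat (Suc k choose u) * f u)
      = f 0 + (\<Sum>u\<le>k. of_nat ((k choose u) + (k choose Suc u)) * f (Suc u))"
    by (subst sum.atMost_Suc_shift) simp
  also have "\<dots> = (\<Sum>u\<le>k. of_nat (k choose u) * f (Suc u))
      + (\<Sum>u\<le>Suc k. of_nat (k choose u) * f u)"
    by (subst sum.atMost_Suc_shift[of "\<lambda>u. of_nat (k choose u) * f u"])
       (simp add: sum.distrib algebra_simps)
  also have "\<dots> = (\<Sum>u\<le>k. of_nat (k choose u) * f (Suc u)) + (\<Sum>u\<le>k. of_nat (k choose u) * f u)"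
    by (simp add: binomial_eq_0)
  finally show ?thesis by (simp add: sum.distrib distrib_left)
qed

text \<open>At most one term is nonzero. Keeping the sum lets the induction run through Pascal's
  rule without separate treatment of the boundary values of \<open>u\<close>.\<close>

lemma card_walks_alcove_eq_sum:
  fixes h l :: "'n::{finite,linorder} \<Rightarrow> int"
  assumes l: "l \<in> alcove_int m" and m: "m > 0"
  shows "h \<in> alcove_int m \<Longrightarrow>
    of_nat (card (walks standard_steps (alcove_A m) (int_vec h) (int_vec l) k))
    = (\<Sum>u\<le>k. of_nat (k choose u) *
        (if 2 * int u - int k = (\<Sum>a\<in>UNIV. l a) - (\<Sum>a\<in>UNIV. h a)
         then propagator m l u (k - u) h else 0))"
proof (induction k arbitrary: h)
  case 0
  show ?case
  proof (cases "(\<Sum>a\<in>UNIV. h a) = (\<Sum>a\<in>UNIV. l a)")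
    case True
    thus ?thesis
      using 0 l m by (simp add: walks_0 int_vec_in_alcove_iff int_vec_eq_iff propagator_0)
  next
    case False
    hence "h \<noteq> l" by auto
    thus ?thesis
      using 0 False by (simp add: walks_0 int_vec_in_alcove_iff int_vec_eq_iff)
  qed
next
  case (Suc k)
  define W where "W g = card (walks standard_steps (alcove_A m) (int_vec g) (int_vec l) k)"
    for g :: "'n \<Rightarrow> int"
  define F where "F g = (\<Sum>u\<le>k. of_nat (k choose u) *
      (if 2 * int u - int k = (\<Sum>a\<in>UNIV. l a) - (\<Sum>a\<in>UNIV. g a)
       then propagator m l u (k - u) g else 0))" for g :: "'n \<Rightarrow> int"
  define D where "D = (\<Sum>a\<in>UNIV. l a) - (\<Sum>a\<in>UNIV. h a)"
  \<comment> \<open>The induction hypothesis speaks of alcove points only. A neighbour outside lies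
    on a wall, where no walk starts and the propagator is 0.\<close>
  have WF: "of_nat (W (h(c := h c + e))) = F (h(c := h c + e))" if e: "e = 1 \<or> e = -1" for c e
  proof (cases "h(c := h c + e) \<in> alcove_int m")
    case True
    thus ?thesis unfolding W_def F_def by (rule Suc.IH)
  next
    case False
    obtain i j where "i \<noteq> j" "int m dvd (h(c := h c + e)) i - (h(c := h c + e)) j"
      using alcove_int_exit[OF Suc.prems m e False] by blast
    hence "propagator m l u d (h(c := h c + e)) = 0" for u d
      using m by (rule propagator_wall[rotated])
    hence "F (h(c := h c + e)) = 0" unfolding F_def by (intro sum.neutral) auto
    moreover have "W (h(c := h c + e)) = 0"
      using False by (simp add: W_def walks_outside int_vec_in_alcove_iff)
    ultimately show ?thesis by simp
  qed
  have sum_upd: "(\<Sum>a\<in>UNIV. (h(c := h c + e)) a) = (\<Sum>a\<in>UNIV. h a) + e" for c e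
  proof -
    have "(\<Sum>a\<in>UNIV. (h(c := h c + e)) a) = (\<Sum>a\<in>UNIV. h a + (if a = c then e else 0))"
      by (intro sum.cong) auto
    thus ?thesis by (simp add: sum.distrib)
  qed
  have step: "card (walks standard_steps (alcove_A m) (int_vec h) (int_vec l) (Suc k))
      = (\<Sum>c\<in>UNIV. W (h(c := h c + 1)) + W (h(c := h c + -1)))"
    unfolding W_def int_vec_step[symmetric]
    using Suc.prems
    by (subst card_walks_Suc)
       (simp_all add: int_vec_in_alcove_iff finite_standard_steps sum_standard_steps)
  have step_F: "of_nat (card (walks standard_steps (alcove_A m) (int_vec h) (int_vec l) (Suc k)))
      = (\<Sum>c\<in>UNIV. F (h(c := h c + 1))) + (\<Sum>c\<in>UNIV. F (h(c := h c + -1)))"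
    unfolding step of_nat_sum of_nat_add WF[OF disjI1[OF refl]] WF[OF disjI2[OF refl]] by (rule sum.distrib)
  have up: "(\<Sum>c\<in>UNIV. F (h(c := h c + 1))) = (\<Sum>u\<le>k. of_nat (k choose u) *
      (if 2 * int (Suc u) - int (Suc k) = D then propagator m l (Suc u) (k - u) h else 0))"
    unfolding F_def sum_upd
  proof (subst sum.swap, intro sum.cong refl)
    fix u
    have "2 * int u - int k = (\<Sum>a\<in>UNIV. l a) - ((\<Sum>a\<in>UNIV. h a) + 1)
        \<longleftrightarrow> 2 * int (Suc u) - int (Suc k) = D" by (auto simp: D_def)
    thus "(\<Sum>c\<in>UNIV. of_nat (k choose u) *
          (if 2 * int u - int k = (\<Sum>a\<in>UNIV. l a) - ((\<Sum>a\<in>UNIV. h a) + 1)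
           then propagator m l u (k - u) (h(c := h c + 1)) else 0))
        = of_nat (k choose u) * (if 2 * int (Suc u) - int (Suc k) = D
           then propagator m l (Suc u) (k - u) h else 0)"
      by (cases "2 * int (Suc u) - int (Suc k) = D") (simp_all only: simp_thms if_True if_False mult_zero_right
          sum.neutral_const sum_distrib_left[symmetric] propagator_up[OF m])
  qed
  have down: "(\<Sum>c\<in>UNIV. F (h(c := h c + -1))) = (\<Sum>u\<le>k. of_nat (k choose u) *
      (if 2 * int u - int (Suc k) = D then propagator m l u (Suc k - u) h else 0))"
    unfolding F_def sum_upd
  proof (subst sum.swap, intro sum.cong refl)
    fix u assume "u \<in> {..k}"
    hence "Suc k - u = Suc (k - u)" by (simp add: Suc_diff_le)
    moreover have "2 * int u - int k = (\<Sum>a\<in>UNIV. l a) - ((\<Sum>a\<in>UNIV. h a) + -1)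
        \<longleftrightarrow> 2 * int u - int (Suc k) = D" by (auto simp: D_def)
    ultimately show "(\<Sum>c\<in>UNIV. of_nat (k choose u) *
          (if 2 * int u - int k = (\<Sum>a\<in>UNIV. l a) - ((\<Sum>a\<in>UNIV. h a) + -1)
           then propagator m l u (k - u) (h(c := h c + -1)) else 0))
        = of_nat (k choose u) * (if 2 * int u - int (Suc k) = D
           then propagator m l u (Suc k - u) h else 0)"
      by (cases "2 * int u - int (Suc k) = D") (simp_all only: simp_thms if_True if_False mult_zero_right
          sum.neutral_const sum_distrib_left[symmetric] propagator_down[OF m])
  qed
  show ?case
    unfolding step_F up down D_def[symmetric] sum_binomial_Suc
    by (simp only: distrib_left sum.distrib diff_Suc_Suc)
qed

lemma card_walks_alcove:
  fixes h l :: "'n::{finite,linorder} \<Rightarrow> int"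
  assumes "l \<in> alcove_int m" "m > 0" "h \<in> alcove_int m"
    and u: "u \<le> k" "2 * int u - int k = (\<Sum>a\<in>UNIV. l a) - (\<Sum>a\<in>UNIV. h a)"
  shows "of_nat (card (walks standard_steps (alcove_A m) (int_vec h) (int_vec l) k))
    = of_nat (k choose u) * propagator m l u (k - u) h"
proof -
  have "2 * int v - int k = (\<Sum>a\<in>UNIV. l a) - (\<Sum>a\<in>UNIV. h a) \<longleftrightarrow> v = u" for v
    using u(2) by linarith
  hence "(\<Sum>v\<le>k. of_nat (k choose v) *
        (if 2 * int v - int k = (\<Sum>a\<in>UNIV. l a) - (\<Sum>a\<in>UNIV. h a)
         then propagator m l v (k - v) h else 0))
      = (\<Sum>v\<le>k. if v = u then of_nat (k choose u) * propagator m l u (k - u) h else 0)"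
    by (intro sum.cong) auto
  thus ?thesis using u(1) by (simp add: card_walks_alcove_eq_sum assms(1-3))
qed

section \<open>Maximal sums of distinct roots of unity\<close>

abbreviation prim_root :: "nat \<Rightarrow> complex" where
  "prim_root m \<equiv> cis (2 * pi / real m)"

lemma prim_root_power_inj:
  assumes "n \<le> m"
  shows "inj_on (\<lambda>i. prim_root m ^ i) {..<n}"
proof (rule inj_onI)
  fix i j assume ij: "i \<in> {..<n}" "j \<in> {..<n}" "prim_root m ^ i = prim_root m ^ j"
  hence "prim_root m powi (int i - int j) = 1" by (simp add: power_int_diff)
  hence "int m dvd int i - int j" using primitive_root_powi_eq_1_iff ij assms by auto
  thus "i = j" using ij assms zdvd_imp_le[of "int m" "int i - int j"]
    zdvd_imp_le[of "int m" "int j - int i"] by (cases i j rule: linorder_cases) (auto simp: dvd_diff_commute)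
qed

text \<open>In the expansion of the squared modulus of \<open>A + (w - z)\<close> the term
  \<open>cmod (w - z) ^ 2\<close> is positive, so at a maximum the linear term must be negative. The
  strictness later rules out ties.\<close>

lemma exchange_strict:
  assumes T: "finite T" "z \<in> T" "w \<notin> T"
    and max: "cmod (\<Sum>(insert w (T - {z}))) \<le> cmod (\<Sum>T)"
  shows "Re (cnj (\<Sum>T) * w) < Re (cnj (\<Sum>T) * z)"
proof -
  define A where "A = \<Sum>T"
  have "\<Sum>(insert w (T - {z})) = A + (w - z)"
    using T by (simp add: A_def sum_diff1)
  hence "cmod (A + (w - z)) ^ 2 \<le> cmod A ^ 2"
    using max by (simp add: A_def power_mono)
  moreover have "cmod (A + (w - z)) ^ 2
      = cmod A ^ 2 + 2 * (Re (cnj A * w) - Re (cnj A * z)) + cmod (w - z) ^ 2"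
    unfolding cmod_power2 by (simp add: algebra_simps power2_eq_square)
  moreover have "cmod (w - z) ^ 2 > 0" using T by auto
  ultimately have "Re (cnj A * w) < Re (cnj A * z)" by argo
  thus ?thesis by (simp add: A_def)
qed

text \<open>By the exchange inequality a maximiser consists of the roots in a half-plane
  \<open>Re (cnj A * z) > t\<close>; the exponents of these roots, taken in a window of length \<open>m\<close> centred
  at the argument of \<open>A\<close>, have no gaps because the cosine is unimodal there.\<close>

lemma maximiser_is_arc:
  assumes m: "m > 0" and T: "T \<subseteq> unity_roots m" "T \<noteq> {}"
    and max: "\<And>T'. T' \<subseteq> unity_roots m \<Longrightarrow> card T' = card T \<Longrightarrow> cmod (\<Sum>T') \<le> cmod (\<Sum>T)"
  shows "\<exists>\<zeta>\<in>unity_roots m. T = (\<lambda>i. \<zeta> * prim_root m ^ i) ` {..<card T}"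
proof -
  have finT: "finite T" using T finite_unity_roots[OF m] finite_subset by blast
  define A where "A = \<Sum>T"
  define \<phi> where "\<phi> = Arg A"
  define x where "x k = 2 * pi / real m * of_int k - \<phi>" for k :: int
  \<comment> \<open>The window is half-open of length 2 pi, so it meets each residue class of
    exponents modulo \<open>m\<close> exactly once.\<close>
  define K where "K = {k. - pi < x k \<and> x k \<le> pi \<and> prim_root m powi k \<in> T}"
  have A: "A = of_real (cmod A) * cis \<phi>"
    unfolding \<phi>_def using rcis_cmod_Arg[of A] by (simp add: rcis_def)
  have Re_eq: "Re (cnj A * prim_root m powi k) = cmod A * cos (x k)" for k
  proof -
    have "cnj A * prim_root m powi k = of_real (cmod A) * cis (x k)"
      by (subst A) (simp add: cis_power_int cis_cnj cis_mult x_def mult_ac)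
    thus ?thesis by simp
  qed
  have root_powi: "prim_root m powi k \<in> unity_roots m" for k
    using primitive_root_powi_eq_1_iff[OF m, of "k * int m"]
    by (simp add: unity_roots_def power_int_power')
  have x_diff: "x k - x l = 2 * pi / real m * of_int (k - l)" for k l
    by (simp add: x_def algebra_simps diff_divide_distrib)
  have convex: "l \<in> K" if "i \<in> K" "k \<in> K" "i \<le> l" "l \<le> k" for i k l
  proof (rule ccontr)
    assume nl: "l \<notin> K"
    have le: "x i \<le> x l" "x l \<le> x k"
      using that(3,4) unfolding x_def by (auto intro!: mult_left_mono divide_right_mono)
    hence "prim_root m powi l \<notin> T" using that(1,2) nl by (auto simp: K_def)
    hence less: "cmod A * cos (x l) < cmod A * cos (x j)" if "j \<in> K" for j
    proof -
      define z w where "z = prim_root m powi j" and "w = prim_root m powi l"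
      have zw: "z \<in> T" "w \<notin> T" using that \<open>prim_root m powi l \<notin> T\<close> by (auto simp: K_def z_def w_def)
      have "card (insert w (T - {z})) = card T"
        using zw finT by (simp add: card_Suc_Diff1 del: card_Diff_insert)
      hence "cmod (\<Sum>(insert w (T - {z}))) \<le> cmod (\<Sum>T)"
        using T root_powi[of l] by (intro max) (auto simp: w_def)
      hence "Re (cnj A * w) < Re (cnj A * z)"
        unfolding A_def by (rule exchange_strict[OF finT zw])
      thus ?thesis unfolding z_def w_def Re_eq .
    qed
    have "cos (x i) \<le> cos (x l) \<or> cos (x k) \<le> cos (x l)"
    proof (cases "x l \<ge> 0")
      case True
      thus ?thesis using le that(2) by (intro disjI2 cos_monotone_0_pi_le) (auto simp: K_def)
    next
      case False
      hence "cos (- x i) \<le> cos (- x l)"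
        using le that(1) by (intro cos_monotone_0_pi_le) (auto simp: K_def)
      thus ?thesis by simp
    qed
    thus False using less[OF that(1)] less[OF that(2)] mult_left_mono[of _ "cos (x l)" "cmod A"]
      by (metis norm_ge_zero not_less)
  qed
  have bij: "bij_betw (\<lambda>k. prim_root m powi k) K T"
    unfolding bij_betw_def
  proof (intro conjI inj_onI equalityI subsetI)
    fix k l assume kl: "k \<in> K" "l \<in> K" "prim_root m powi k = prim_root m powi l"
    hence "prim_root m powi (k - l) = 1" by (simp add: power_int_diff)
    hence dvd: "int m dvd k - l" using primitive_root_powi_eq_1_iff m by blast
    have "\<bar>x k - x l\<bar> < 2 * pi" using kl by (auto simp: K_def)
    hence "2 * pi / real m * \<bar>real_of_int (k - l)\<bar> < 2 * pi / real m * real m"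
      using m unfolding x_diff abs_mult by simp
    hence "\<bar>real_of_int (k - l)\<bar> < real m"
      by (rule mult_left_less_imp_less) simp
    hence "\<bar>k - l\<bar> < int m" by linarith
    thus "k = l" using dvd by (metis dvd_imp_le_int eq_iff_diff_eq_0 linorder_not_less abs_of_nat)
  next
    fix z assume z: "z \<in> T"
    then obtain j :: nat where j: "z = cis (2 * pi * real j / real m)"
      using T(1) bij_betw_imp_surj_on[OF Complex.bij_betw_roots_unity[OF m]] by (fastforce simp: unity_roots_def)
    \<comment> \<open>\<open>c\<close> is the number of full turns to be subtracted so that the
      angle of the given root falls into the window.\<close>
    define c where "c = \<lceil>(x (int j) - pi) / (2 * pi)\<rceil>"
    have c: "of_int c - 1 < (x (int j) - pi) / (2 * pi)" "(x (int j) - pi) / (2 * pi) \<le> of_int c"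
      unfolding c_def by linarith+
    define k where "k = int j - int m * c"
    have xk: "x k = x (int j) - 2 * pi * of_int c"
      using m by (simp add: x_def k_def field_simps)
    have "- pi < x k" "x k \<le> pi" using c by (simp_all add: xk field_simps)
    moreover have "prim_root m powi k = z"
    proof -
      have "prim_root m powi k = prim_root m powi int j"
        by (rule unity_roots_powi_cong[OF m primitive_root_in[OF m]]) (simp add: k_def)
      also have "\<dots> = z" by (simp add: j Complex.DeMoivre mult_ac)
      finally show ?thesis .
    qed
    ultimately show "z \<in> (\<lambda>k. prim_root m powi k) ` K" using z by (auto simp: K_def intro!: image_eqI[of _ _ k])
  qed (auto simp: K_def)
  have finK: "finite K" using bij_betw_finite[OF bij] finT by simp
  have K: "K \<noteq> {}" using bij T(2) by (auto simp: bij_betw_def)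
  define a b where "a = Min K" and "b = Max K"
  have K_eq: "K = {a..b}"
  proof (intro equalityI subsetI)
    fix k assume "k \<in> {a..b}"
    thus "k \<in> K" using convex[of a b k] Min_in[OF finK K] Max_in[OF finK K] by (simp add: a_def b_def)
  qed (use finK in \<open>simp add: a_def b_def\<close>)
  have cardK: "card T = nat (b - a + 1)"
    using bij_betw_same_card[OF bij] unfolding K_eq by simp
  have "K = (\<lambda>i. a + int i) ` {..<card T}"
  proof (intro equalityI subsetI)
    fix k assume "k \<in> K"
    thus "k \<in> (\<lambda>i. a + int i) ` {..<card T}"
      unfolding K_eq cardK by (intro image_eqI[of _ _ "nat (k - a)"]) auto
  qed (auto simp: K_eq cardK)
  hence "T = (\<lambda>i. prim_root m powi (a + int i)) ` {..<card T}"
    using bij by (simp add: bij_betw_def image_image)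
  also have "\<dots> = (\<lambda>i. prim_root m powi a * prim_root m ^ i) ` {..<card T}"
    by (simp add: power_int_add)
  finally show ?thesis using root_powi by blast
qed

lemma sum_arc:
  assumes "n \<le> m" "\<zeta> \<noteq> 0"
  shows "\<Sum>((\<lambda>i. \<zeta> * prim_root m ^ i) ` {..<n}) = \<zeta> * (\<Sum>i<n. prim_root m ^ i)"
proof -
  have "inj_on (\<lambda>i. \<zeta> * prim_root m ^ i) {..<n}"
    using prim_root_power_inj[OF assms(1)] assms(2) by (auto simp: inj_on_def)
  thus ?thesis by (simp add: sum.reindex sum_distrib_left)
qed

text \<open>A maximum over the finitely many subsets of this size exists and is attained only by
  arcs; all arcs of one size are rotations of each other, which determines its value.\<close>

lemma sum_unity_roots_less:
  assumes m: "m > 0" and T: "T \<subseteq> unity_roots m" "T \<noteq> {}"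
    and not_arc: "\<And>\<zeta>. \<zeta> \<in> unity_roots m \<Longrightarrow> T \<noteq> (\<lambda>i. \<zeta> * prim_root m ^ i) ` {..<card T}"
  shows "cmod (\<Sum>T) < cmod (\<Sum>i<card T. prim_root m ^ i)"
proof -
  define C where "C = {T'. T' \<subseteq> unity_roots m \<and> card T' = card T}"
  have fin: "finite C" using finite_unity_roots[OF m] by (auto simp: C_def intro: finite_subset[of _ "Pow _"])
  have TC: "T \<in> C" using T by (simp add: C_def)
  define M where "M = Max ((\<lambda>T'. cmod (\<Sum>T')) ` C)"
  have le: "cmod (\<Sum>T') \<le> M" if "T' \<in> C" for T' using that fin by (simp add: M_def)
  have "M \<in> (\<lambda>T'. cmod (\<Sum>T')) ` C" unfolding M_def using fin TC by (intro Max_in) auto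
  then obtain T0 where T0: "T0 \<in> C" "cmod (\<Sum>T0) = M" by auto
  have "finite T" using T finite_unity_roots[OF m] finite_subset by blast
  hence "card T > 0" using T(2) by (simp add: card_gt_0_iff)
  have arc: "\<exists>\<zeta>\<in>unity_roots m. T' = (\<lambda>i. \<zeta> * prim_root m ^ i) ` {..<card T}"
    if "T' \<in> C" "cmod (\<Sum>T') = M" for T'
    using maximiser_is_arc[OF m, of T'] le that \<open>card T > 0\<close> by (force simp: C_def)
  have "card T \<le> m" using card_mono[OF finite_unity_roots[OF m] T(1)] card_unity_roots[OF m] by simp
  obtain \<zeta> where "\<zeta> \<in> unity_roots m" "T0 = (\<lambda>i. \<zeta> * prim_root m ^ i) ` {..<card T}"
    using arc[OF T0] by blast
  hence "M = cmod (\<Sum>i<card T. prim_root m ^ i)"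
    using T0(2) sum_arc[OF \<open>card T \<le> m\<close>, of \<zeta>] unity_roots_nonzero[OF m] unity_roots_norm[OF m]
    by (simp add: norm_mult)
  moreover have "cmod (\<Sum>T) \<noteq> M" using arc[OF TC] not_arc by blast
  ultimately show ?thesis using le[OF TC] by simp
qed

section \<open>Tuples that enumerate an arc\<close>

definition arc_tuple :: "nat \<Rightarrow> complex \<Rightarrow> ('n::{finite,linorder} \<Rightarrow> 'n) \<Rightarrow> 'n \<Rightarrow> complex" where
  "arc_tuple m \<zeta> p a = \<zeta> * prim_root m ^ idx (p a)"

lemma sum_root_tuple_less:
  fixes z :: "'n::{finite,linorder} \<Rightarrow> complex"
  assumes m: "m > 0" and z: "z \<in> root_tuples m" "inj z"
    and not_arc: "\<And>\<zeta> p. \<zeta> \<in> unity_roots m \<Longrightarrow> p permutes UNIV \<Longrightarrow> z \<noteq> arc_tuple m \<zeta> p"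
  shows "cmod (\<Sum>a\<in>UNIV. z a) < cmod (\<Sum>i<CARD('n). prim_root m ^ i)"
proof -
  have card: "card (range z) = CARD('n)" using z(2) by (simp add: card_image)
  have "range z \<noteq> (\<lambda>i. \<zeta> * prim_root m ^ i) ` {..<CARD('n)}" if \<zeta>: "\<zeta> \<in> unity_roots m" for \<zeta>
  proof
    assume eq: "range z = (\<lambda>i. \<zeta> * prim_root m ^ i) ` {..<CARD('n)}"
    also have "{..<CARD('n)} = range (idx :: 'n \<Rightarrow> nat)"
      using bij_betw_idx[where 'n = 'n] by (simp add: bij_betw_def)
    finally have "\<exists>b. z a = \<zeta> * prim_root m ^ idx (b :: 'n)" for a by (auto simp: set_eq_iff image_iff)
    then obtain p where p: "z a = \<zeta> * prim_root m ^ idx (p a :: 'n)" for a by metis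
    have "inj p" using z(2) p by (metis injI inj_eq)
    hence "p permutes UNIV" by (intro bij_imp_permutes) (auto simp: bij_def finite_UNIV_inj_surj)
    thus False using not_arc[OF \<zeta>, of p] p by (auto simp: arc_tuple_def fun_eq_iff)
  qed
  hence "cmod (\<Sum>(range z)) < cmod (\<Sum>i<CARD('n). prim_root m ^ i)"
    using sum_unity_roots_less[OF m, of "range z"] z(1) by (auto simp: card root_tuples_iff)
  thus ?thesis using z(2) by (simp add: sum.reindex)
qed

lemma arc_tuple_in: "m > 0 \<Longrightarrow> \<zeta> \<in> unity_roots m \<Longrightarrow> arc_tuple m \<zeta> p \<in> root_tuples m"
  using primitive_root_in[of m]
  by (auto simp: root_tuples_iff arc_tuple_def unity_roots_def power_mult_distrib
      power_mult[symmetric] mult.commute[of _ m] simp flip: power_mult)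
     (simp add: power_mult)

lemma sum_arc_tuple:
  fixes p :: "'n::{finite,linorder} \<Rightarrow> 'n"
  assumes "p permutes UNIV"
  shows "(\<Sum>a\<in>UNIV. arc_tuple m \<zeta> p a) = \<zeta> * (\<Sum>i<CARD('n). prim_root m ^ i)"
proof -
  have "(\<Sum>a\<in>UNIV. arc_tuple m \<zeta> p a) = (\<Sum>a\<in>UNIV. \<zeta> * prim_root m ^ idx (a::'n))"
    using sum.permute[OF assms, of "\<lambda>a. \<zeta> * prim_root m ^ idx a"] by (simp add: arc_tuple_def o_def)
  thus ?thesis
    by (simp add: sum_distrib_left[symmetric] sum.reindex_bij_betw[OF bij_betw_idx])
qed

text \<open>If \<open>\<zeta>\<close> were a later element of the arc starting at
  \<open>\<xi>\<close>, its predecessor would also lie in the arc starting at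
  \<open>\<zeta>\<close>, which would then go round the whole circle, against \<open>n < m\<close>.
  For n = m > 1 every arc is the whole circle and injectivity fails, hence the hypothesis
  \<open>nm\<close>.\<close>

lemma arc_tuple_inj:
  assumes m: "m > 0" and nm: "CARD('n::{finite,linorder}) < m \<or> CARD('n) = 1"
  shows "inj_on (\<lambda>(\<zeta>, p :: 'n \<Rightarrow> 'n). arc_tuple m \<zeta> p) (unity_roots m \<times> {p. p permutes UNIV})"
proof (rule inj_onI, clarify)
  fix \<zeta> \<xi> and p q :: "'n \<Rightarrow> 'n"
  assume \<zeta>: "\<zeta> \<in> unity_roots m" and \<xi>: "\<xi> \<in> unity_roots m"
    and p: "p permutes UNIV" and q: "q permutes UNIV"
    and eq: "arc_tuple m \<zeta> p = arc_tuple m \<xi> q"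
  define n where "n = CARD('n)"
  have nm': "n \<le> m" using nm m by (auto simp: n_def)
  define w where "w = prim_root m"
  have w0: "w \<noteq> 0" by (simp add: w_def)
  have arc_eq: "range (arc_tuple m \<zeta> p) = (\<lambda>i. \<zeta> * w ^ i) ` {..<n}" if "p permutes UNIV"
    for \<zeta> and p :: "'n \<Rightarrow> 'n"
  proof -
    have "range (arc_tuple m \<zeta> p) = (\<lambda>i. \<zeta> * w ^ i) ` (idx ` range p)"
      by (auto simp: arc_tuple_def w_def)
    thus ?thesis using permutes_surj[OF that] bij_betw_idx[where 'n = 'n]
      by (simp add: bij_betw_def n_def)
  qed
  have sets: "(\<lambda>i. \<zeta> * w ^ i) ` {..<n} = (\<lambda>i. \<xi> * w ^ i) ` {..<n}"
    using arc_eq[OF p, of \<zeta>] arc_eq[OF q, of \<xi>] eq by simp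
  have "n > 0" by (simp add: n_def)
  hence "\<zeta> \<in> (\<lambda>i. \<xi> * w ^ i) ` {..<n}" using sets by (force simp: image_iff)
  then obtain r where r: "r < n" "\<zeta> = \<xi> * w ^ r" by auto
  have "r = 0"
  proof (rule ccontr)
    assume "r \<noteq> 0"
    hence "\<xi> * w ^ (r - 1) \<in> (\<lambda>i. \<zeta> * w ^ i) ` {..<n}" using sets r(1) by auto
    then obtain s where s: "s < n" "\<xi> * w ^ (r - 1) = \<zeta> * w ^ s" by auto
    have "\<xi> \<noteq> 0" using \<xi> m unity_roots_nonzero by blast
    hence "w ^ (r - 1) = w ^ (r - 1) * w ^ (s + 1)"
      using s(2) \<open>r \<noteq> 0\<close> by (cases r) (simp_all add: r(2) power_add mult_ac)
    hence "w ^ (s + 1) = 1" using w0 by (simp del: power_Suc)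
    hence "w powi int (s + 1) = 1" by (simp only: power_int_of_nat)
    hence "int m dvd int (s + 1)" unfolding w_def using primitive_root_powi_eq_1_iff[OF m] by blast
    hence "m \<le> s + 1" by (intro dvd_imp_le) (auto simp only: int_dvd_int_iff)
    thus False using s(1) r(1) \<open>r \<noteq> 0\<close> nm by (auto simp: n_def)
  qed
  hence \<zeta>\<xi>: "\<zeta> = \<xi>" using r by simp
  have "p a = q a" for a
  proof -
    have "w ^ idx (p a) = w ^ idx (q a)"
      using fun_cong[OF eq, of a] \<zeta>\<xi> unity_roots_nonzero[OF m \<xi>] by (simp add: arc_tuple_def w_def)
    moreover have "idx (p a) < n" "idx (q a) < n"
      using bij_betw_idx[where 'n = 'n, THEN bij_betwE] by (auto simp: n_def)
    ultimately have "idx (p a) = idx (q a)"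
      using inj_onD[OF prim_root_power_inj[OF nm']] by (simp add: w_def)
    thus ?thesis by (simp add: inj_eq[OF inj_idx])
  qed
  thus "\<zeta> = \<xi> \<and> p = q" using \<zeta>\<xi> by auto
qed

text \<open>The chord formula is the source of the sines, both in the quotient
  \<open>sin_quotient\<close> and in the product over pairs.\<close>

lemma cis_diff: "cis a - cis b = 2 * \<i> * of_real (sin ((a - b) / 2)) * cis ((a + b) / 2)"
proof -
  have "cos a - cos b = - 2 * sin ((a - b) / 2) * sin ((a + b) / 2)"
    using cos_diff_cos[of a b] sin_minus[of "(a - b) / 2"]
    by (simp add: minus_divide_left)
  moreover have "sin a - sin b = 2 * sin ((a - b) / 2) * cos ((a + b) / 2)"
    using sin_diff_sin[of a b] by simp
  ultimately show ?thesis by (simp add: complex_eq_iff)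
qed

text \<open>A geometric series; the phase is the direction of the midpoint of the arc. The case
  \<open>n = 1\<close> stands apart because it allows \<open>m = 1\<close>, where the ratio of the
  series is 1.\<close>

lemma sum_prim_root:
  assumes m: "m > 0" and nm: "n < m \<or> n = 1" and n: "n > 0"
  shows "(\<Sum>i<n. prim_root m ^ i) = of_real (sin_quotient n m) * cis (pi * (real n - 1) / real m)"
proof (cases "n = 1")
  case True
  thus ?thesis by (simp add: sin_quotient_def)
next
  case False
  hence m2: "m > 1" using nm n by auto
  define s where "s = sin (pi / real m)"
  have s: "s > 0" unfolding s_def using m2 by (intro sin_gt_zero) (auto simp: field_simps)
  have w1: "prim_root m - 1 = 2 * \<i> * of_real s * cis (pi / real m)"
    using cis_diff[of "2 * pi / real m" 0] by (simp add: s_def)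
  have wn: "prim_root m ^ n - 1 = 2 * \<i> * of_real (sin (real n * pi / real m)) * cis (real n * pi / real m)"
    using cis_diff[of "real n * (2 * pi / real m)" 0] by (simp add: Complex.DeMoivre)
  have "prim_root m \<noteq> 1" using w1 s by auto
  hence "(\<Sum>i<n. prim_root m ^ i) = (prim_root m ^ n - 1) / (prim_root m - 1)"
    by (rule geometric_sum)
  also have "\<dots> = of_real (sin (real n * pi / real m) / s) * (cis (real n * pi / real m) / cis (pi / real m))"
    unfolding w1 wn using s by simp
  also have "cis (real n * pi / real m) / cis (pi / real m) = cis (pi * (real n - 1) / real m)"
    by (simp add: cis_divide diff_divide_distrib algebra_simps)
  finally show ?thesis using False by (simp add: sin_quotient_def s_def)
qed

lemma sin_quotient_pos:
  assumes "m > 0" "n < m \<or> n = 1" "n > 0"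
  shows "sin_quotient n m > 0"
proof (cases "n = 1")
  case False
  thus ?thesis using assms
    by (auto simp: sin_quotient_def field_simps intro!: divide_pos_pos sin_gt_zero)
qed (simp add: sin_quotient_def)

section \<open>Binomial coefficients near the middle\<close>

text \<open>These are the coefficients of (1 + x)^(-1/2). In this form central binomial coefficients
  fall under \<open>gbinomial_asymptotic\<close>, and Gamma(1/2) = sqrt pi supplies the
  constant.\<close>

lemma neg_half_gbinomial: "((-1/2 :: real) gchoose n) = (-1) ^ n * real (2 * n choose n) / 4 ^ n"
proof (induction n)
  case (Suc n)
  define B where "B = real (2 * Suc n choose Suc n)"
  have B: "real (Suc n) * B = 2 * real (2 * n + 1) * real (2 * n choose n)"
  proof -
    have absorb: "Suc n * (Suc (2 * n) choose Suc n) = Suc (2 * n) * (2 * n choose n)"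
      by (rule Suc_times_binomial)
    have "Suc (2 * n) choose Suc n = Suc (2 * n) choose n"
      using binomial_symmetric[of n "Suc (2 * n)"] by (simp add: Suc_diff_le)
    hence "2 * Suc n choose Suc n = 2 * (Suc (2 * n) choose Suc n)" by simp
    hence "Suc n * (2 * Suc n choose Suc n) = 2 * (Suc n * (Suc (2 * n) choose Suc n))"
      by (simp only: mult.left_commute)
    hence "Suc n * (2 * Suc n choose Suc n) = 2 * (Suc (2 * n) * (2 * n choose n))"
      by (simp only: absorb)
    from arg_cong[OF this, of real] show ?thesis
      by (simp only: B_def of_nat_mult of_nat_numeral Suc_eq_plus1 mult.assoc)
  qed
  have "real (Suc n) * ((-1/2 :: real) gchoose Suc n) = (-1/2 - real n) * ((-1/2) gchoose n)"
    using gbinomial_mult_1[of "-1/2 :: real" n] by (simp add: algebra_simps)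
  also have "\<dots> = - ((-1) ^ n / (2 * 4 ^ n)) * (real (2 * n + 1) * real (2 * n choose n))"
    unfolding Suc.IH by (simp add: field_simps)
  also have "\<dots> = - ((-1) ^ n / (4 * 4 ^ n)) * (real (Suc n) * B)"
    unfolding B by (simp add: field_simps)
  also have "\<dots> = real (Suc n) * ((-1) ^ Suc n * B / 4 ^ Suc n)"
    by simp
  finally show ?case unfolding B_def by (subst (asm) mult_cancel_left) simp
qed simp

lemma central_binomial_asymp:
  "(\<lambda>n. real (2 * n choose n)) \<sim>[at_top] (\<lambda>n. 4 ^ n / sqrt (pi * real n))"
proof (rule asymp_equivI')
  have "(\<lambda>n. ((-1/2 :: real) gchoose n) / ((-1) ^ n / exp ((-1/2 + 1) * of_real (ln (real n)))))
      \<longlonglongrightarrow> inverse (Gamma (- (-1/2 :: real)))"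
    by (rule gbinomial_asymptotic)
  hence "(\<lambda>n. sqrt pi * (((-1/2 :: real) gchoose n) / ((-1) ^ n / exp ((-1/2 + 1) * of_real (ln (real n))))))
      \<longlonglongrightarrow> sqrt pi * inverse (sqrt pi)"
    by (intro tendsto_mult tendsto_const) (simp add: Gamma_one_half_real)
  hence lim: "(\<lambda>n. sqrt pi * (((-1/2 :: real) gchoose n) / ((-1) ^ n / exp ((-1/2 + 1) * of_real (ln (real n))))))
      \<longlonglongrightarrow> 1" by simp
  show "(\<lambda>n. real (2 * n choose n) / (4 ^ n / sqrt (pi * real n))) \<longlonglongrightarrow> 1"
  proof (rule Lim_transform_eventually[OF lim])
    show "\<forall>\<^sub>F n in sequentially. sqrt pi * (((-1/2 :: real) gchoose n) /
        ((-1) ^ n / exp ((-1/2 + 1) * of_real (ln (real n)))))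
        = real (2 * n choose n) / (4 ^ n / sqrt (pi * real n))"
      using eventually_gt_at_top[of 0]
    proof eventually_elim
      case (elim n)
      have "exp ((-1/2 + 1) * of_real (ln (real n))) = sqrt (real n)"
        using elim by (simp add: powr_half_sqrt[symmetric] powr_def)
      thus ?case by (simp add: neg_half_gbinomial[simplified] real_sqrt_mult)
    qed
  qed
qed

text \<open>Even \<open>k\<close> is the central case. For odd \<open>k\<close>, (2n+2 choose n+1) =
  2 (2n+1 choose n) leads to the next even number; the 2 cancels against the power of 2 and a square
  root tending to 1 remains.\<close>

lemma middle_binomial_asymp:
  "(\<lambda>k. real (k choose (k div 2))) \<sim>[at_top] (\<lambda>k. 2 ^ k * sqrt (2 / (pi * real k)))"
proof -
  define f where "f k = real (k choose (k div 2)) / (2 ^ k * sqrt (2 / (pi * real k)))" for k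
  have c: "(\<lambda>n. real (2 * n choose n) / (4 ^ n / sqrt (pi * real n))) \<longlonglongrightarrow> 1"
    using central_binomial_asymp by (rule asymp_equivD_strong) (auto intro!: eventually_mono[OF eventually_gt_at_top[of 0]])
  have even: "(\<lambda>n. f (2 * n)) \<longlonglongrightarrow> 1"
  proof (rule Lim_transform_eventually[OF c], rule eventually_mono[OF eventually_gt_at_top[of 0]])
    fix n :: nat assume "n > 0"
    thus "real (2 * n choose n) / (4 ^ n / sqrt (pi * real n)) = f (2 * n)"
      by (simp add: f_def power_mult real_sqrt_divide)
  qed
  have odd: "(\<lambda>n. f (2 * n + 1)) \<longlonglongrightarrow> 1"
  proof -
    have "(\<lambda>n. f (2 * Suc n) * sqrt (real (2 * n + 1) / real (2 * n + 2))) \<longlonglongrightarrow> 1 * sqrt 1"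
    proof (intro tendsto_mult tendsto_real_sqrt LIMSEQ_Suc[OF even])
      have "(\<lambda>n. 1 - 1 / real (2 * n + 2)) \<longlonglongrightarrow> 1 - 0"
      proof (intro tendsto_diff tendsto_const)
        have "(\<lambda>n. inverse (2::real) * inverse (real (Suc n))) \<longlonglongrightarrow> inverse 2 * 0"
          by (intro tendsto_mult tendsto_const LIMSEQ_inverse_real_of_nat)
        thus "(\<lambda>n. 1 / real (2 * n + 2)) \<longlonglongrightarrow> 0"
          by (simp add: field_simps)
      qed
      moreover have "(1 - 1 / real (2 * n + 2)) = real (2 * n + 1) / real (2 * n + 2)" for n
        by (simp add: field_simps)
      ultimately show "(\<lambda>n. real (2 * n + 1) / real (2 * n + 2)) \<longlonglongrightarrow> 1" by simp
    qed
    moreover have "f (2 * Suc n) * sqrt (real (2 * n + 1) / real (2 * n + 2)) = f (2 * n + 1)" for n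
    proof -
      have "Suc (2 * n) choose Suc n = Suc (2 * n) choose n"
        using binomial_symmetric[of n "Suc (2 * n)"] by (simp add: Suc_diff_le)
      hence b: "2 * Suc n choose Suc n = 2 * (Suc (2 * n) choose n)" by simp
      have "f (2 * Suc n) = 2 * real (Suc (2 * n) choose n) / (2 ^ (2 * n + 2) * sqrt (2 / (pi * real (2 * n + 2))))"
        unfolding f_def nonzero_mult_div_cancel_left[OF zero_neq_numeral[symmetric]] b by simp
      moreover have "f (2 * n + 1) = real (Suc (2 * n) choose n) / (2 ^ (2 * n + 1) * sqrt (2 / (pi * real (2 * n + 1))))"
        by (simp add: f_def)
      ultimately show ?thesis
        by (simp add: real_sqrt_divide real_sqrt_mult mult_ac)
    qed
    ultimately show ?thesis by simp
  qed
  have "f \<longlonglongrightarrow> 1"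
  proof (rule topological_tendstoI)
    fix S :: "real set" assume S: "open S" "1 \<in> S"
    obtain N1 where N1: "\<And>n. n \<ge> N1 \<Longrightarrow> f (2 * n) \<in> S"
      using topological_tendstoD[OF even S] unfolding eventually_sequentially by blast
    obtain N2 where N2: "\<And>n. n \<ge> N2 \<Longrightarrow> f (2 * n + 1) \<in> S"
      using topological_tendstoD[OF odd S] unfolding eventually_sequentially by blast
    have "f k \<in> S" if "k \<ge> 2 * (N1 + N2) + 1" for k
    proof (cases "even k")
      case True
      then obtain n where "k = 2 * n" by (rule evenE)
      thus ?thesis using N1[of n] that by simp
    next
      case False
      then obtain n where "k = 2 * n + 1" by (rule oddE)
      thus ?thesis using N2[of n] that by simp
    qed
    thus "\<forall>\<^sub>F k in sequentially. f k \<in> S" unfolding eventually_sequentially by blast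
  qed
  thus ?thesis unfolding f_def by (rule asymp_equivI')
qed

text \<open>Consecutive coefficients have ratio (k - u) / (u + 1); at bounded distance from the
  middle, numerator and denominator differ by a bounded amount.\<close>

lemma binomial_shift_ratio:
  "(\<lambda>k. real (k choose nat (int (k div 2) + (j + 1))) / real (k choose nat (int (k div 2) + j))) \<longlonglongrightarrow> 1"
proof -
  define u where "u k = nat (int (k div 2) + j)" for k
  have bound: "\<forall>\<^sub>F k in sequentially.
      norm (real (k choose nat (int (k div 2) + (j + 1))) / real (k choose u k) - 1)
      \<le> (2 + 2 * \<bar>of_int j\<bar>) * (1 / real (Suc (u k)))"
    \<comment> \<open>The threshold keeps \<open>nat\<close> from truncating and guarantees
      \<open>u k < k\<close>.\<close>
    using eventually_ge_at_top[of "nat (4 * \<bar>j\<bar> + 4)"]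
  proof eventually_elim
    case (elim k)
    have u: "int (u k) = int (k div 2) + j" and uk: "u k < k"
      using elim unfolding u_def by linarith+
    have Suc: "nat (int (k div 2) + (j + 1)) = Suc (u k)" using u by simp
    have "Suc (u k) * (k choose Suc (u k)) = (k - u k) * (k choose u k)"
      by (simp only: binomial_absorption binomial_absorb_comp)
    hence "real (Suc (u k)) * real (k choose Suc (u k)) = (real k - real (u k)) * real (k choose u k)"
      using uk by (metis of_nat_diff of_nat_mult less_imp_le)
    moreover have "real (k choose u k) > 0" using uk by simp
    ultimately have "real (k choose Suc (u k)) / real (k choose u k) - 1
        = (real k - 2 * real (u k) - 1) * (1 / real (Suc (u k)))"
      by (simp add: field_simps)
    moreover have "\<bar>real k - 2 * real (u k) - 1\<bar> \<le> 2 + 2 * \<bar>of_int j\<bar>"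
    proof -
      have "\<bar>int k - 2 * int (u k) - 1\<bar> \<le> 2 + 2 * \<bar>j\<bar>" using u by linarith
      thus ?thesis by linarith
    qed
    ultimately show ?case
      by (simp add: Suc abs_mult del: of_nat_Suc) (intro divide_right_mono, auto)
  qed
  have "filterlim u at_top at_top"
    unfolding filterlim_at_top
  proof
    fix Z
    show "\<forall>\<^sub>F k in sequentially. Z \<le> u k"
      using eventually_ge_at_top[of "2 * (Z + nat \<bar>j\<bar>)"]
    proof eventually_elim
      case (elim k)
      hence "Z + nat \<bar>j\<bar> \<le> k div 2" by simp
      thus ?case unfolding u_def by linarith
    qed
  qed
  hence "filterlim (\<lambda>k. Suc (u k)) at_top at_top"
    by (rule filterlim_at_top_mono) (simp add: eventually_sequentially)
  hence "(\<lambda>k. 1 / real (Suc (u k))) \<longlonglongrightarrow> 0"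
    by (intro real_tendsto_divide_at_top[OF tendsto_const] filterlim_compose[OF filterlim_real_sequentially])
  hence "(\<lambda>k. (2 + 2 * \<bar>of_int j\<bar>) * (1 / real (Suc (u k)))) \<longlonglongrightarrow> (2 + 2 * \<bar>of_int j\<bar>) * 0"
    by (intro tendsto_mult tendsto_const)
  hence "(\<lambda>k. (2 + 2 * \<bar>of_int j\<bar>) * (1 / real (Suc (u k)))) \<longlonglongrightarrow> 0" by simp
  hence "(\<lambda>k. real (k choose nat (int (k div 2) + (j + 1))) / real (k choose u k) - 1) \<longlonglongrightarrow> 0"
    by (rule Lim_null_comparison[OF bound])
  thus ?thesis unfolding u_def by (simp add: LIM_zero_iff)
qed

lemma near_middle_binomial_asymp:
  "(\<lambda>k. real (k choose nat (int (k div 2) + j))) \<sim>[at_top] (\<lambda>k. 2 ^ k * sqrt (2 / (pi * real k)))"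
proof (induction j rule: int_induct[where k = 0])
  case base
  thus ?case using middle_binomial_asymp by simp
next
  case (step1 j)
  show ?case
    using asymp_equivI'[OF binomial_shift_ratio[of j]] step1(2) by (rule asymp_equiv_trans)
next
  case (step2 j)
  have "(\<lambda>k. real (k choose nat (int (k div 2) + j)))
      \<sim>[at_top] (\<lambda>k. real (k choose nat (int (k div 2) + (j - 1))))"
    using asymp_equivI'[OF binomial_shift_ratio[of "j - 1"]] by simp
  hence "(\<lambda>k. real (k choose nat (int (k div 2) + (j - 1))))
      \<sim>[at_top] (\<lambda>k. real (k choose nat (int (k div 2) + j)))"
    by (rule asymp_equiv_symI)
  thus ?case using step2(2) by (rule asymp_equiv_trans)
qed

section \<open>The contribution of the arcs and the asymptotics\<close>

text \<open>Every index belongs to n - 1 pairs. The constant function 1 then counts the pairs, and a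
  function of angles yields the total phase of a Vandermonde product.\<close>

lemma sum_pairs:
  fixes f :: "'n::{finite,linorder} \<Rightarrow> 'a::comm_ring_1"
  shows "(\<Sum>(i, j)\<in>{(i, j). i < j}. f i + f j) = (of_nat CARD('n) - 1) * (\<Sum>i\<in>UNIV. f i)"
proof -
  have "(\<Sum>(i, j)\<in>{(i :: 'n, j). i < j}. f i + f j)
      = (\<Sum>(i, j)\<in>{(i, j). i < j}. f i) + (\<Sum>(i, j)\<in>{(i, j). i < j}. f j)"
    by (simp add: case_prod_unfold sum.distrib)
  also have "(\<Sum>(i, j)\<in>{(i :: 'n, j). i < j}. f j) = (\<Sum>(i, j)\<in>{(i, j). j < i}. f i)"
    by (rule sum.reindex_bij_witness[where i = prod.swap and j = prod.swap]) auto
  also have "(\<Sum>(i, j)\<in>{(i :: 'n, j). i < j}. f i) + \<dots> = (\<Sum>(i, j)\<in>{(i, j). i < j} \<union> {(i, j). j < i}. f i)"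
    by (rule sum.union_disjoint[symmetric]) auto
  also have "{(i :: 'n, j). i < j} \<union> {(i, j). j < i} = Sigma UNIV (\<lambda>i. UNIV - {i})"
    by (auto simp: neq_iff)
  also have "(\<Sum>(i, j)\<in>Sigma UNIV (\<lambda>i :: 'n. UNIV - {i}). f i) = (\<Sum>i\<in>UNIV. \<Sum>j\<in>UNIV - {i}. f i)"
    by (rule sum.Sigma[symmetric]) auto
  also have "\<dots> = (\<Sum>i\<in>UNIV. (of_nat CARD('n) - 1) * f i)"
    by (intro sum.cong refl) (simp add: card_Diff_singleton of_nat_diff Suc_leI)
  finally show ?thesis by (simp add: sum_distrib_left)
qed

lemma card_pairs: "2 * card {(i :: 'n::{finite,linorder}, j). i < j} = CARD('n)\<^sup>2 - CARD('n)"
proof -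
  have "int (2 * card {(i :: 'n, j). i < j}) = (int CARD('n) - 1) * int CARD('n)"
    using sum_pairs[of "\<lambda>_ :: 'n. 1 :: int"] by (simp add: case_prod_unfold)
  also have "\<dots> = int (CARD('n)\<^sup>2 - CARD('n))"
    by (subst of_nat_diff) (auto simp: power2_eq_square algebra_simps)
  finally show ?thesis by linarith
qed

text \<open>The free-fermion determinant \<open>det (z a powi h b)\<close> for the arc starting at
  1, with the two exponents exchanged so that Vandermonde's formula applies.\<close>

definition slater :: "nat \<Rightarrow> ('n::{finite,linorder} \<Rightarrow> int) \<Rightarrow> complex" where
  "slater m h = det (\<chi> a b. (prim_root m powi h b) ^ idx a)"

text \<open>By the chord formula each pair contributes 4 times two sines and a phase. The n(n-1)/2
  factors 4 give the power of 2, and \<open>sum_pairs\<close> collects the phases.\<close>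

lemma slater_mult_cnj:
  fixes h l :: "'n::{finite,linorder} \<Rightarrow> int"
  shows "slater m h * cnj (slater m l)
    = of_real (2 ^ (CARD('n)\<^sup>2 - CARD('n)) * (\<Prod>(i, j)\<in>{(i, j). i < j}.
        sin (pi * (of_int (h i) - of_int (h j)) / real m) *
        sin (pi * (of_int (l i) - of_int (l j)) / real m)))
      * cis (pi * (real CARD('n) - 1) / real m) powi ((\<Sum>a\<in>UNIV. h a) - (\<Sum>a\<in>UNIV. l a))"
proof -
  define S where "S g i j = sin (pi * (of_int (g i) - of_int (g j)) / real m)"
    for g :: "'n \<Rightarrow> int" and i j
  define e where "e a = pi * (of_int (h a) - of_int (l a)) / real m" for a
  have diff: "prim_root m powi g j - prim_root m powi g i
      = - (2 * \<i> * of_real (S g i j) * cis (pi * (of_int (g i) + of_int (g j)) / real m))"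
    for g :: "'n \<Rightarrow> int" and i j
  proof -
    have "prim_root m powi g i - prim_root m powi g j
        = 2 * \<i> * of_real (S g i j) * cis (pi * (of_int (g i) + of_int (g j)) / real m)"
      unfolding cis_power_int cis_diff S_def by (simp add: algebra_simps add_divide_distrib diff_divide_distrib)
    thus ?thesis by (metis minus_diff_eq)
  qed
  have pair: "(prim_root m powi h j - prim_root m powi h i) * cnj (prim_root m powi l j - prim_root m powi l i)
      = of_real (4 * (S h i j * S l i j)) * cis (e i + e j)" for i j
  proof -
    have "cis (e i + e j) = cis (pi * (of_int (h i) + of_int (h j)) / real m)
        * cnj (cis (pi * (of_int (l i) + of_int (l j)) / real m))"
      by (simp add: cis_cnj cis_mult e_def algebra_simps add_divide_distrib diff_divide_distrib)
    thus ?thesis unfolding diff by simp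
  qed
  have "slater m h * cnj (slater m l)
      = (\<Prod>(i, j)\<in>{(i, j). i < j}. of_real (4 * (S h i j * S l i j)) * cis (e i + e j))"
    unfolding slater_def det_vandermonde pair[symmetric]
    by (simp add: case_prod_unfold prod.distrib)
  also have "\<dots> = of_real (4 ^ card {(i :: 'n, j). i < j} * (\<Prod>(i, j)\<in>{(i, j). i < j}. S h i j * S l i j))
      * (\<Prod>(i, j)\<in>{(i, j). i < j}. cis (e i + e j))"
    by (simp add: case_prod_unfold prod.distrib)
  also have "(4::real) ^ card {(i :: 'n, j). i < j} = 2 ^ (CARD('n)\<^sup>2 - CARD('n))"
    unfolding card_pairs[symmetric] by (simp add: power_mult)
  also have "(\<Prod>(i, j)\<in>{(i, j). i < j}. cis (e i + e j)) = cis (\<Sum>(i, j)\<in>{(i, j). i < j}. e i + e j)"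
  proof -
    have "finite X \<Longrightarrow> (\<Prod>x\<in>X. cis (g x)) = cis (\<Sum>x\<in>X. g x)" for X :: "('n \<times> 'n) set" and g
      by (induction X rule: finite_induct) (auto simp: cis_mult)
    thus ?thesis by (simp add: case_prod_unfold)
  qed
  also have "(\<Sum>(i, j)\<in>{(i :: 'n, j). i < j}. e i + e j)
      = of_int ((\<Sum>a\<in>UNIV. h a) - (\<Sum>a\<in>UNIV. l a)) * (pi * (real CARD('n) - 1) / real m)"
    unfolding sum_pairs e_def
    by (simp add: sum_divide_distrib[symmetric] sum_distrib_left[symmetric] sum_subtractf mult_ac)
  finally show ?thesis by (simp add: cis_power_int S_def)
qed

lemma powi_sum: "z \<noteq> 0 \<Longrightarrow> finite X \<Longrightarrow> (\<Prod>x\<in>X. z powi f x) = (z :: 'a :: field) powi (\<Sum>x\<in>X. f x)"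
  by (induction X rule: infinite_finite_induct) (auto simp: power_int_add)

text \<open>Column \<open>b\<close> releases \<open>\<zeta>\<close> with exponent
  \<open>h b\<close>, in total the coordinate sum, and sorting the rows costs \<open>sign p\<close>.
  What is left of \<open>l\<close> is one Leibniz term of \<open>cnj (slater m l)\<close>.\<close>

lemma amplitude_arc_tuple:
  fixes h l :: "'n::{finite,linorder} \<Rightarrow> int"
  assumes \<zeta>: "\<zeta> \<noteq> 0" and p: "p permutes UNIV"
  shows "amplitude l h (arc_tuple m \<zeta> p) = \<zeta> powi ((\<Sum>a\<in>UNIV. h a) - (\<Sum>a\<in>UNIV. l a)) * slater m h *
      (of_int (sign p) * (\<Prod>a\<in>UNIV. cnj ((prim_root m powi l a) ^ idx (p a))))"
proof -
  define V :: "complex ^ 'n::{finite,linorder} ^ 'n::{finite,linorder}"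
    where "V = (\<chi> a b. (prim_root m powi h b) ^ idx a)"
  have powi_swap: "(prim_root m ^ i) powi x = (prim_root m powi x) ^ i" for i x
    by (simp add: power_int_power power_int_power' mult.commute)
  have "det (\<chi> a b. arc_tuple m \<zeta> p a powi h b)
      = (\<Sum>q | q permutes UNIV. of_int (sign q) * (\<Prod>a\<in>UNIV. \<zeta> powi h (q a) * V $ p a $ q a))"
    by (simp add: det_def arc_tuple_def V_def power_int_mult_distrib powi_swap)
  also have "\<dots> = (\<Sum>q | q permutes UNIV. \<zeta> powi (\<Sum>a\<in>UNIV. h a) *
      (of_int (sign q) * (\<Prod>a\<in>UNIV. (\<chi> a. V $ p a) $ a $ q a)))"
  proof (intro sum.cong refl)
    fix q :: "'n \<Rightarrow> 'n" assume "q \<in> {q. q permutes UNIV}"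
    hence "(\<Sum>a\<in>UNIV. h (q a)) = (\<Sum>a\<in>UNIV. h a)" using sum.permute[of q UNIV h] by simp
    hence "(\<Prod>a\<in>UNIV. \<zeta> powi h (q a)) = \<zeta> powi (\<Sum>a\<in>UNIV. h a)" using \<zeta> by (simp add: powi_sum)
    thus "of_int (sign q) * (\<Prod>a\<in>UNIV. \<zeta> powi h (q a) * V $ p a $ q a)
        = \<zeta> powi (\<Sum>a\<in>UNIV. h a) * (of_int (sign q) * (\<Prod>a\<in>UNIV. (\<chi> a. V $ p a) $ a $ q a))"
      by (simp add: prod.distrib)
  qed
  also have "\<dots> = \<zeta> powi (\<Sum>a\<in>UNIV. h a) * det (\<chi> a. V $ p a)"
    by (simp add: det_def sum_distrib_left)
  also have "det (\<chi> a. V $ p a) = of_int (sign p) * slater m h"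
    unfolding det_permute_rows[OF p] by (simp add: slater_def V_def)
  finally have det: "det (\<chi> a b. arc_tuple m \<zeta> p a powi h b)
      = \<zeta> powi (\<Sum>a\<in>UNIV. h a) * (of_int (sign p) * slater m h)" .
  have "(\<Prod>a\<in>UNIV. arc_tuple m \<zeta> p a powi (- l a))
      = (\<Prod>a\<in>UNIV. \<zeta> powi (- l a)) * (\<Prod>a\<in>UNIV. cnj ((prim_root m powi l a) ^ idx (p a)))"
    by (simp add: arc_tuple_def power_int_mult_distrib powi_swap prod.distrib cnj_powi_unit
        del: complex_cnj_power_int)
  also have "(\<Prod>a\<in>UNIV. \<zeta> powi (- l a)) = \<zeta> powi (- (\<Sum>a\<in>UNIV. l a))"
    using \<zeta> by (simp add: powi_sum sum_negf)
  finally show ?thesis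
    unfolding amplitude_def det using \<zeta> by (simp add: power_int_diff power_int_minus field_simps)
qed

text \<open>The orderings of the arc run through the whole Leibniz expansion, taken for the
  transposed matrix; here the single monomial of \<open>amplitude\<close> becomes a
  determinant.\<close>

lemma sum_amplitude_arc_tuples:
  fixes h l :: "'n::{finite,linorder} \<Rightarrow> int"
  assumes "\<zeta> \<noteq> 0"
  shows "(\<Sum>p | p permutes UNIV. amplitude l h (arc_tuple m \<zeta> p))
    = \<zeta> powi ((\<Sum>a\<in>UNIV. h a) - (\<Sum>a\<in>UNIV. l a)) * (slater m h * cnj (slater m l))"
proof -
  have "cnj (slater m l) = (\<Sum>p | p permutes UNIV. of_int (sign p) *
      (\<Prod>a\<in>UNIV. cnj ((prim_root m powi l a) ^ idx (p a))))"
  proof -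
    have "slater m l = det (transpose (\<chi> a b. (prim_root m powi l b) ^ idx a))"
      by (simp add: slater_def)
    thus ?thesis by (simp add: det_def transpose_def)
  qed
  thus ?thesis
    using amplitude_arc_tuple[OF assms, of _ l h m] by (simp add: sum_distrib_left mult_ac)
qed

definition arc_tuples :: "nat \<Rightarrow> ('n::{finite,linorder} \<Rightarrow> complex) set" where
  "arc_tuples m = (\<lambda>(\<zeta>, p). arc_tuple m \<zeta> p) ` (unity_roots m \<times> {p. p permutes UNIV})"

text \<open>The eigenvalues carry the phase \<open>(\<zeta> * \<kappa>) powi D\<close>, the
  amplitudes its inverse. So all \<open>m\<close> arcs contribute the same real number, which is the
  origin of the factor \<open>real m\<close>.\<close>

lemma arc_contribution:
  fixes h l :: "'n::{finite,linorder} \<Rightarrow> int"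
  assumes m: "m > 0" and nm: "CARD('n) < m \<or> CARD('n) = 1"
    and ud: "int u - int d = (\<Sum>a\<in>UNIV. l a) - (\<Sum>a\<in>UNIV. h a)"
  shows "(\<Sum>z\<in>arc_tuples m. amplitude l h z * (\<Sum>a\<in>UNIV. z a) ^ u * cnj (\<Sum>a\<in>UNIV. z a) ^ d)
    = of_real (real m * sin_quotient CARD('n) m ^ (u + d) * (2 ^ (CARD('n)\<^sup>2 - CARD('n)) *
        (\<Prod>(i, j)\<in>{(i, j). i < j}.
          sin (pi * (of_int (h i) - of_int (h j)) / real m) *
          sin (pi * (of_int (l i) - of_int (l j)) / real m))))"
    (is "_ = of_real (real m * ?s ^ (u + d) * ?P)")
proof -
  define \<kappa> where "\<kappa> = cis (pi * (real CARD('n) - 1) / real m)"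
  define D where "D = (\<Sum>a\<in>UNIV. l a) - (\<Sum>a\<in>UNIV. h a)"
  have D': "(\<Sum>a\<in>UNIV. h a) - (\<Sum>a\<in>UNIV. l a) = - D" by (simp add: D_def)
  have powers: "(\<Sum>a\<in>UNIV. z a) ^ u * cnj (\<Sum>a\<in>UNIV. z a) ^ d = of_real (?s ^ (u + d)) * (\<zeta> * \<kappa>) powi D"
    if \<zeta>: "\<zeta> \<in> unity_roots m" and p: "p permutes UNIV" and z: "z = arc_tuple m \<zeta> p"
    for \<zeta> p and z :: "'n \<Rightarrow> complex"
  proof -
    have A: "(\<Sum>a\<in>UNIV. z a) = of_real ?s * (\<zeta> * \<kappa>)"
      unfolding z sum_arc_tuple[OF p] \<kappa>_def using m nm by (subst sum_prim_root) auto
    have "cmod (\<zeta> * \<kappa>) = 1" using unity_roots_norm[OF m \<zeta>] by (simp add: norm_mult \<kappa>_def)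
    hence "cnj (\<zeta> * \<kappa>) ^ d = (\<zeta> * \<kappa>) powi (- int d)" and nz: "\<zeta> * \<kappa> \<noteq> 0"
      using cnj_powi_unit[of "\<zeta> * \<kappa>" "int d"] by auto
    hence "(\<zeta> * \<kappa>) ^ u * cnj (\<zeta> * \<kappa>) ^ d = (\<zeta> * \<kappa>) powi (int u + - int d)"
      by (subst power_int_add) auto
    thus ?thesis unfolding A using ud by (simp add: D_def power_add power_mult_distrib mult_ac)
  qed
  have fin: "finite {p :: 'n \<Rightarrow> 'n. p permutes UNIV}" by (rule finite_permutations) simp
  have "(\<Sum>z\<in>arc_tuples m. amplitude l h z * (\<Sum>a\<in>UNIV. z a) ^ u * cnj (\<Sum>a\<in>UNIV. z a) ^ d)
      = (\<Sum>x\<in>unity_roots m \<times> {p :: 'n \<Rightarrow> 'n. p permutes UNIV}.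
          (\<lambda>z. amplitude l h z * (\<Sum>a\<in>UNIV. z a) ^ u * cnj (\<Sum>a\<in>UNIV. z a) ^ d)
            (case x of (\<zeta>, p) \<Rightarrow> arc_tuple m \<zeta> p))"
    unfolding arc_tuples_def by (subst sum.reindex[OF arc_tuple_inj[OF m nm]]) (simp add: o_def)
  also have "\<dots> = (\<Sum>x\<in>unity_roots m \<times> {p :: 'n \<Rightarrow> 'n. p permutes UNIV}.
      amplitude l h (arc_tuple m (fst x) (snd x)) * (of_real (?s ^ (u + d)) * (fst x * \<kappa>) powi D))"
    by (intro sum.cong refl) (auto simp: mult.assoc powers simp del: cnj_sum)
  also have "\<dots> = (\<Sum>\<zeta>\<in>unity_roots m. (\<Sum>p | p permutes (UNIV :: 'n set).
      amplitude l h (arc_tuple m \<zeta> p)) * (of_real (?s ^ (u + d)) * (\<zeta> * \<kappa>) powi D))"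
    by (simp add: sum.cartesian_product case_prod_unfold sum_distrib_right)
  also have "\<dots> = (\<Sum>\<zeta>\<in>unity_roots m. of_real (?s ^ (u + d) * ?P))"
  proof (intro sum.cong refl)
    fix \<zeta> assume "\<zeta> \<in> unity_roots m"
    hence \<zeta>: "\<zeta> \<noteq> 0" by (rule unity_roots_nonzero[OF m])
    have "\<zeta> powi (- D) * (of_real ?P * \<kappa> powi (- D)) * (of_real (?s ^ (u + d)) * (\<zeta> * \<kappa>) powi D)
        = of_real (?s ^ (u + d) * ?P) * ((\<zeta> powi (- D) * \<zeta> powi D) * (\<kappa> powi (- D) * \<kappa> powi D))"
      by (simp only: power_int_mult_distrib of_real_mult mult_ac)
    also have "(\<zeta> powi (- D) * \<zeta> powi D) * (\<kappa> powi (- D) * \<kappa> powi D) = 1"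
      using \<zeta> by (simp add: power_int_minus \<kappa>_def)
    finally show "(\<Sum>p | p permutes (UNIV :: 'n set). amplitude l h (arc_tuple m \<zeta> p)) *
        (of_real (?s ^ (u + d)) * (\<zeta> * \<kappa>) powi D) = of_real (?s ^ (u + d) * ?P)"
      unfolding sum_amplitude_arc_tuples[OF \<zeta>] slater_mult_cnj D' \<kappa>_def[symmetric] by simp
  qed
  finally show ?thesis using m by (simp add: card_unity_roots mult_ac)
qed

section \<open>The remaining tuples and the degenerate case n = m\<close>

lemma amplitude_not_inj: "\<not> inj z \<Longrightarrow> amplitude l h z = 0"
proof -
  assume "\<not> inj z"
  then obtain i j where ij: "i \<noteq> j" "z i = z j" by (auto simp: inj_def)
  have "det (\<chi> a b. z a powi h b) = 0"
    using ij by (intro det_identical_rows[OF ij(1)]) (auto simp: row_def)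
  thus ?thesis by (simp add: amplitude_def)
qed

text \<open>Conjugation preserves the modulus, so the bound on the remaining tuples depends on
  \<open>k\<close> but not on \<open>u\<close>.\<close>

lemma propagator_expansion:
  fixes h l :: "'n::{finite,linorder} \<Rightarrow> int"
  assumes m: "m > 0" and nm: "CARD('n) < m \<or> CARD('n) = 1"
    and k: "u \<le> k" "2 * int u - int k = (\<Sum>a\<in>UNIV. l a) - (\<Sum>a\<in>UNIV. h a)"
  defines "s \<equiv> sin_quotient CARD('n) m"
  shows "cmod (propagator m l u (k - u) h / of_real (s ^ k) - of_real (2 ^ (CARD('n)\<^sup>2 - CARD('n)) / real m ^ (CARD('n) - 1) *
        (\<Prod>(i, j)\<in>{(i, j). i < j}.
          sin (pi * (of_int (h i) - of_int (h j)) / real m) *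
          sin (pi * (of_int (l i) - of_int (l j)) / real m))))
    \<le> (\<Sum>z\<in>root_tuples m - arc_tuples m. cmod (amplitude l h z) * (cmod (\<Sum>a\<in>UNIV. z a) / s) ^ k)"
    (is "cmod (_ - of_real (?Q / _ * ?S)) \<le> _")
proof -
  have s: "s > 0" unfolding s_def using m nm by (intro sin_quotient_pos) auto
  define M where "M = (of_nat m ^ CARD('n) :: complex)"
  define rest where "rest = (\<Sum>z\<in>root_tuples m - arc_tuples m.
      amplitude l h z * (\<Sum>a\<in>UNIV. z a) ^ u * cnj (\<Sum>a\<in>UNIV. z a) ^ (k - u))"
  have M: "M \<noteq> 0" "cmod M \<ge> 1" using m by (simp_all add: M_def norm_power)
  have sub: "arc_tuples m \<subseteq> root_tuples m" using arc_tuple_in[OF m] by (auto simp: arc_tuples_def)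
  have "propagator m l u (k - u) h = (rest + of_real (real m * s ^ (u + (k - u)) * (?Q * ?S))) / M"
    unfolding propagator_def rest_def s_def M_def using k
    by (subst sum.subset_diff[OF sub finite_root_tuples[OF m]], subst arc_contribution[OF m nm])
       (auto simp: of_nat_diff)
  also have "u + (k - u) = k" using k(1) by simp
  finally have expand: "propagator m l u (k - u) h = (rest + of_real (real m * s ^ k * (?Q * ?S))) / M" .
  have Mm: "M = of_nat m * of_real (real m ^ (CARD('n) - 1))"
    by (simp add: M_def flip: power_Suc)
  have "propagator m l u (k - u) h / of_real (s ^ k) - of_real (?Q / real m ^ (CARD('n) - 1) * ?S)
      = rest / of_real (s ^ k) / M"
    unfolding expand using s m by (simp add: Mm add_divide_distrib)
  also have "cmod \<dots> = cmod (rest / of_real (s ^ k)) / cmod M" by (rule norm_divide)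
  \<comment> \<open>The divisor m^n is at least 1 and is dropped from the upper bound.\<close>
  also have "\<dots> \<le> cmod (rest / of_real (s ^ k)) / 1"
    using M by (intro divide_left_mono) auto
  also have "\<dots> = cmod rest / s ^ k" using s by (simp add: norm_divide norm_power)
  also have "cmod rest \<le> (\<Sum>z\<in>root_tuples m - arc_tuples m. cmod (amplitude l h z) * cmod (\<Sum>a\<in>UNIV. z a) ^ k)"
    unfolding rest_def
  proof (rule sum_norm_le)
    fix z :: "'n \<Rightarrow> complex"
    have "cmod (\<Sum>a\<in>UNIV. z a) ^ u * cmod (\<Sum>a\<in>UNIV. z a) ^ (k - u) = cmod (\<Sum>a\<in>UNIV. z a) ^ k"
      using k(1) by (simp flip: power_add)
    thus "cmod (amplitude l h z * (\<Sum>a\<in>UNIV. z a) ^ u * cnj (\<Sum>a\<in>UNIV. z a) ^ (k - u))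
        \<le> cmod (amplitude l h z) * cmod (\<Sum>a\<in>UNIV. z a) ^ k"
      by (simp add: norm_mult norm_power complex_mod_cnj mult.assoc del: cnj_sum)
  qed
  finally show ?thesis using s by (simp add: sum_divide_distrib divide_right_mono power_divide)
qed

text \<open>Tuples with repeated roots can have larger sums than an arc, up to modulus n, but their
  amplitude vanishes. The injective ones that are not arcs have ratio below 1.\<close>

lemma rest_tendsto_0:
  fixes h l :: "'n::{finite,linorder} \<Rightarrow> int"
  assumes m: "m > 0" and nm: "CARD('n) < m \<or> CARD('n) = 1"
  shows "(\<lambda>k. \<Sum>z\<in>root_tuples m - arc_tuples m. cmod (amplitude l h z) *
      (cmod (\<Sum>a\<in>UNIV. z a) / sin_quotient CARD('n) m) ^ k) \<longlonglongrightarrow> 0"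
proof (rule tendsto_null_sum)
  fix z :: "'n \<Rightarrow> complex" assume z: "z \<in> root_tuples m - arc_tuples m"
  have s: "sin_quotient CARD('n) m > 0" using m nm by (intro sin_quotient_pos) auto
  show "(\<lambda>k. cmod (amplitude l h z) * (cmod (\<Sum>a\<in>UNIV. z a) / sin_quotient CARD('n) m) ^ k) \<longlonglongrightarrow> 0"
  proof (cases "inj z")
    case True
    have "cmod (\<Sum>a\<in>UNIV. z a) < cmod (\<Sum>i<CARD('n). prim_root m ^ i)"
      using z True by (intro sum_root_tuple_less m) (auto simp: arc_tuples_def)
    also have "\<dots> = sin_quotient CARD('n) m"
      using m nm s by (subst sum_prim_root) (auto simp: norm_mult)
    finally have "norm (cmod (\<Sum>a\<in>UNIV. z a) / sin_quotient CARD('n) m) < 1"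
      using s by simp
    thus ?thesis by (intro tendsto_mult_right_zero LIMSEQ_power_zero)
  next
    case False
    thus ?thesis by (simp add: amplitude_not_inj)
  qed
qed

text \<open>Distinct coordinates differ by less than \<open>m\<close>, so they occupy distinct
  residue classes.\<close>

lemma card_le_modulus:
  fixes h :: "'n::{finite,linorder} \<Rightarrow> int"
  assumes "h \<in> alcove_int m"
  shows "CARD('n) \<le> m"
proof -
  have m: "m > 0" using alcove_int_diff_less[OF assms, of undefined undefined] by simp
  have "inj (\<lambda>a. h a mod int m)"
  proof (rule injI)
    fix a b assume "h a mod int m = h b mod int m"
    hence dvd: "int m dvd h a - h b" by (simp add: mod_eq_dvd_iff)
    have "\<bar>h a - h b\<bar> < int m"
      using alcove_int_diff_less[OF assms, of a b] alcove_int_diff_less[OF assms, of b a] by linarith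
    hence "h a = h b" using dvd by (metis dvd_imp_le_int eq_iff_diff_eq_0 linorder_not_less abs_of_nat)
    thus "a = b" using assms by (cases a b rule: linorder_cases) (force simp: alcove_int_def)+
  qed
  hence "CARD('n) = card (range (\<lambda>a. h a mod int m))" by (simp add: card_image)
  also have "\<dots> \<le> card {0..<int m}" using m by (intro card_mono) auto
  finally show ?thesis by simp
qed

text \<open>An injective tuple exhausts the \<open>m\<close>-th roots, whose sum is 0 for
  \<open>m > 1\<close>. In terms of walks, every residue class is occupied and no coordinate can
  move.\<close>

lemma propagator_full:
  fixes l :: "'n::finite \<Rightarrow> int"
  assumes m: "CARD('n) = m" "m > 1" and ud: "u + d > 0"
  shows "propagator m l u d h = 0"
proof -
  have "amplitude l h z * (\<Sum>a\<in>UNIV. z a) ^ u * cnj (\<Sum>a\<in>UNIV. z a) ^ d = 0"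
    if z: "z \<in> root_tuples m" for z
  proof (cases "inj z")
    case True
    have "range z = unity_roots m"
      using True z m card_unity_roots[of m]
      by (intro card_subset_eq finite_unity_roots) (auto simp: root_tuples_iff card_image)
    moreover have "(\<Sum>a\<in>UNIV. z a) = \<Sum>(range z)" using True by (simp add: sum.reindex)
    ultimately have "(\<Sum>a\<in>UNIV. z a) = 0"
      using sum_roots_unity[of m] m by (simp add: unity_roots_def)
    thus ?thesis using ud by (auto simp del: cnj_sum)
  qed (simp add: amplitude_not_inj)
  hence "(\<Sum>z\<in>root_tuples m. amplitude l h z * (\<Sum>a\<in>UNIV. z a) ^ u * cnj (\<Sum>a\<in>UNIV. z a) ^ d) = 0"
    by (intro sum.neutral ballI)
  thus ?thesis unfolding propagator_def by simp
qed

text \<open>The number (k + D) / 2 of up-steps as \<open>k div 2\<close> plus an offset independent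
  of \<open>k\<close>, as \<open>near_middle_binomial_asymp\<close> requires. When both are odd,
  rounding \<open>D\<close> up compensates rounding \<open>k\<close> down.\<close>

lemma parity_halves:
  fixes D :: int
  assumes "even (int k - D)" "k \<ge> nat \<bar>D\<bar>"
  defines "u \<equiv> nat (int (k div 2) + (D + 1) div 2)"
  shows "2 * int u - int k = D" "u \<le> k"
proof -
  have twice: "2 * (int (k div 2) + (D + 1) div 2) = int k + D"
  proof (cases "even k")
    case True
    hence "even D" using assms(1) by simp
    thus ?thesis using True by (auto elim!: evenE)
  next
    case False
    hence "odd D" using assms(1) by simp
    thus ?thesis using False by (auto elim!: oddE)
  qed
  have "int u = int (k div 2) + (D + 1) div 2"
    using twice assms(2) unfolding u_def by (intro nat_0_le) linarith
  thus "2 * int u - int k = D" using twice by (simp only: algebra_simps)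
  thus "u \<le> k" using assms(2) by linarith
qed

theorem theorem15:
  fixes \<eta> lam :: "real ^ 'n::{finite,linorder}" and m n :: nat
  assumes n: "n = CARD('n)"
    and m: "m > 0"
    and eta_int: "\<forall>j. \<eta> $ j \<in> \<int>"
    and lam_int: "\<forall>j. lam $ j \<in> \<int>"
    and eta: "\<eta> \<in> alcove_A m"
    and lam: "lam \<in> alcove_A m"
  shows "(\<lambda>k. real (card (walks standard_steps (alcove_A m) \<eta> lam k)))
     \<sim>[inf at_top (principal {k. [real k = coord_sum \<eta> + coord_sum lam] (rmod 2)})]
     (\<lambda>k. 2 ^ (n\<^sup>2 - n) / real m ^ (n - 1) * sqrt (2 / (pi * real k))
        * (2 * sin_quotient n m) ^ k
        * (\<Prod>(h, t)\<in>{(h, t). h < t}.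
             sin (pi * (\<eta> $ h - \<eta> $ t) / real m) * sin (pi * (lam $ h - lam $ t) / real m)))"
    (is "?N \<sim>[?F] ?T")
proof -
  define h l where "h j = \<lfloor>\<eta> $ j\<rfloor>" and "l j = \<lfloor>lam $ j\<rfloor>" for j
  have vec: "\<eta> = int_vec h" "lam = int_vec l"
    using eta_int lam_int by (auto simp: int_vec_def vec_eq_iff h_def l_def)
  have h: "h \<in> alcove_int m" and l: "l \<in> alcove_int m"
    using eta lam by (simp_all add: vec int_vec_in_alcove_iff)
  define D where "D = (\<Sum>a\<in>UNIV. l a) - (\<Sum>a\<in>UNIV. h a)"
  define s where "s = sin_quotient n m"
  have nm: "n \<le> m" using card_le_modulus[OF h] by (simp add: n)
  show ?thesis
  proof (cases "n < m \<or> n = 1")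
    \<comment> \<open>Here sin (n pi / m) = sin pi = 0. Both sides are 0 for \<open>k > 0\<close>,
      and asymptotic equivalence counts 0/0 as 1.\<close>
    case False
    hence full: "n = m" "m > 1" using nm m by auto
    have "sin_quotient n m = 0" using full by (simp add: sin_quotient_def)
    hence T0: "?T k = 0" if "k > 0" for k using that by simp
    have N0: "?N k = 0" if "k > 0" for k
    proof -
      have "of_nat (card (walks standard_steps (alcove_A m) \<eta> lam k)) = (0 :: complex)"
        unfolding vec card_walks_alcove_eq_sum[OF l m h]
        using that full n by (intro sum.neutral) (simp add: propagator_full)
      thus ?thesis by simp
    qed
    have "\<forall>\<^sub>F k in at_top. ?N k = ?T k"
      using eventually_gt_at_top[of 0] by eventually_elim (simp only: N0 T0)
    hence "\<forall>\<^sub>F k in ?F. ?N k = ?T k" by (simp add: eventually_inf_principal eventually_mono)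
    thus ?thesis by (rule asymp_equiv_refl_ev)
  next
    case True
    hence nm': "CARD('n) < m \<or> CARD('n) = 1" by (simp add: n)
    have s: "s > 0" unfolding s_def using True m n by (intro sin_quotient_pos) auto
    define P where "P = (\<Prod>(i, j)\<in>{(i, j). i < j}.
        sin (pi * (\<eta> $ i - \<eta> $ j) / real m) * sin (pi * (lam $ i - lam $ j) / real m))"
    define C where "C = 2 ^ (n\<^sup>2 - n) / real m ^ (n - 1) * P"
    \<comment> \<open>All angles lie strictly between 0 and pi. The resulting \<open>C > 0\<close>
      is what turns convergence to \<open>C\<close> into asymptotic equivalence.\<close>
    have "sin (pi * (of_int (g i) - of_int (g j)) / real m) > 0"
      if "g \<in> alcove_int m" "i < j" for g :: "'n \<Rightarrow> int" and i j
    proof (rule sin_gt_zero)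
      have "g j < g i" "g i - g j < int m"
        using that alcove_int_diff_less[OF that(1)] by (auto simp: alcove_int_def)
      hence g: "0 < real_of_int (g i) - of_int (g j)" "real_of_int (g i) - of_int (g j) < real m"
        by linarith+
      show "0 < pi * (of_int (g i) - of_int (g j)) / real m" using g m by simp
      show "pi * (of_int (g i) - of_int (g j)) / real m < pi" using g m by (simp add: divide_less_eq)
    qed
    hence "P > 0"
      unfolding P_def vec using h l by (intro prod_pos) (auto simp: int_vec_def)
    hence C: "C > 0" using m by (simp add: C_def)
    define u where "u k = nat (int (k div 2) + (D + 1) div 2)" for k
    \<comment> \<open>Modulo 2 the sum of the two coordinate sums agrees with their difference
      \<open>D\<close>, which governs the number of up-steps.\<close>
    have parity: "even (int k - D)" if cong: "[real k = coord_sum \<eta> + coord_sum lam] (rmod 2)" for k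
    proof -
      obtain c where "coord_sum \<eta> + coord_sum lam = real k + of_int c * 2"
        using cong unfolding rcong_altdef by blast
      moreover have "coord_sum \<eta> + coord_sum lam = of_int ((\<Sum>a\<in>UNIV. h a) + (\<Sum>a\<in>UNIV. l a))"
        by (simp add: coord_sum_def vec int_vec_def)
      ultimately have "(\<Sum>a\<in>UNIV. h a) + (\<Sum>a\<in>UNIV. l a) = int k + c * 2" by linarith
      thus ?thesis by (simp add: D_def) presburger
    qed
    have ev: "\<forall>\<^sub>F k in ?F. u k \<le> k \<and> 2 * int (u k) - int k = D"
      unfolding eventually_inf_principal using eventually_ge_at_top[of "nat \<bar>D\<bar>"]
      by eventually_elim (use parity parity_halves[of _ D] in \<open>auto simp: u_def\<close>)
    \<comment> \<open>Division by the binomial coefficient and the exponential growth leaves a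
      quantity whose limit is the constant \<open>C\<close>.\<close>
    define f where "f k = ?N k / (real (k choose u k) * s ^ k)" for k
    have "(f \<longlongrightarrow> C) ?F"
    proof (rule Lim_null_comparison[THEN LIM_zero_cancel])
      show "\<forall>\<^sub>F k in ?F. norm (f k - C) \<le> (\<Sum>z\<in>root_tuples m - arc_tuples m.
          cmod (amplitude l h z) * (cmod (\<Sum>a\<in>UNIV. z a) / s) ^ k)"
        using ev
      proof eventually_elim
        case (elim k)
        have "complex_of_real (f k) = propagator m l (u k) (k - u k) h / of_real (s ^ k)"
          using card_walks_alcove[OF l m h, of "u k" k] elim
          by (simp add: f_def D_def vec)
        hence "norm (f k - C) = cmod (propagator m l (u k) (k - u k) h / of_real (s ^ k) - of_real C)"
          by (metis norm_of_real of_real_diff real_norm_def)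
        also have "\<dots> \<le> (\<Sum>z\<in>root_tuples m - arc_tuples m.
            cmod (amplitude l h z) * (cmod (\<Sum>a\<in>UNIV. z a) / s) ^ k)"
          using propagator_expansion[OF m nm', of "u k" k l h] elim
          by (simp add: C_def P_def D_def s_def n vec int_vec_def)
        finally show ?case .
      qed
      show "((\<lambda>k. \<Sum>z\<in>root_tuples m - arc_tuples m.
          cmod (amplitude l h z) * (cmod (\<Sum>a\<in>UNIV. z a) / s) ^ k) \<longlongrightarrow> 0) ?F"
        using rest_tendsto_0[OF m nm', of l h] by (intro tendsto_mono[OF inf_le1]) (simp add: s_def n)
    qed
    hence f: "f \<sim>[?F] (\<lambda>_. C)" using C by (intro tendsto_imp_asymp_equiv_const) auto
    have "(\<lambda>k. real (k choose u k)) \<sim>[?F] (\<lambda>k. 2 ^ k * sqrt (2 / (pi * real k)))"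
      using near_middle_binomial_asymp[of "(D + 1) div 2"]
      unfolding u_def asymp_equiv_def by (rule tendsto_mono[OF inf_le1])
    hence "(\<lambda>k. f k * (real (k choose u k) * s ^ k))
        \<sim>[?F] (\<lambda>k. C * (2 ^ k * sqrt (2 / (pi * real k)) * s ^ k))"
      using f by (intro asymp_equiv_mult asymp_equiv_refl)
    moreover have "\<forall>\<^sub>F k in ?F. ?N k = f k * (real (k choose u k) * s ^ k)"
      using ev by eventually_elim (use s in \<open>simp add: f_def\<close>)
    moreover have "(\<lambda>k. C * (2 ^ k * sqrt (2 / (pi * real k)) * s ^ k)) = ?T"
      by (simp add: fun_eq_iff C_def P_def s_def power_mult_distrib mult_ac)
    ultimately show ?thesis
      using asymp_equiv_cong[of ?N _ ?F ?T ?T] by simp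
  qed
qed

end
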